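(* There is a triangular map $F:[0,1]^2\to[0,1]^2$ such that $F$ has positive topological entropy (and hence $F$ is DC2, i.e. has an uncountable DC2-scrambled set), but no point of $[0,1]^2$ is a DC2-point of $F$.
   Context: Topological entropy is the usual one (Adler–Konheim–McAndrew). A triangular map of the square is a continuous map $F:[0,1]^2\to[0,1]^2$ of the form $F(x,y)=(f(x),g_x(y))$, where $f:[0,1]\to[0,1]$ and $g_x:[0,1]\to[0,1]$ is a family of maps depending continuously on $x\in[0,1]$. $[0,1]^2$ carries its usual metric. Let $(X,d)$ be a compact metric space and $f:X\to X$ continuous; $f^n$ denotes the $n$-th iterate and $B(x_0,\varepsilon)$ the open ball of radius $\varepsilon$ about $x_0$. For $x,y\in X$, $t\in\mathbb{R}$ and $n\ge 1$ let $\xi(x,y,t,n)$ be the number of indices $i\in\{0,1,\dots,n-1\}$ with $d(f^i(x),f^i(y))<t$, and put $$\Psi^n_{xy}(f,t)=\tfrac1n\,\xi(x,y,t,n),\qquad \Psi_{xy}(f,t)=\liminf_{n\to\infty}\Psi^n_{xy}(f,t),\qquad \Psi^*_{xy}(f,t)=\limsup_{n\to\infty}\Psi^n_{xy}(f,t).$$ A pair $x,y$ is a DC2-scrambled pair of $f$ if $\Psi^*_{xy}(f,t)=1$ for all $t>0$ and $\Psi_{xy}(f,t)<\Psi^*_{xy}(f,t)$ for some $t>0$ (equivalently, since $\Psi_{xy}(f,\cdot)$ is non-decreasing, for all sufficiently small $t>0$). A set $S\subseteq X$ is DC2-scrambled for $f$ if every pair of distinct points of $S$ is a DC2-scrambled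 pair of $f$. The map $f$ is DC2 if it has an uncountable DC2-scrambled set. A point $x_0\in X$ is a DC2-point of $f$ if for every $\varepsilon>0$ there exist an uncountable DC2-scrambled set $S_\varepsilon$ for $f$, a positive integer $n(\varepsilon)$, and a closed set $A_\varepsilon\supseteq S_\varepsilon$ such that $A_\varepsilon\subseteq f^{n(\varepsilon)}(A_\varepsilon)\subseteq B(x_0,\varepsilon)$. *)

theory Defs
  imports "HOL-Analysis.Analysis"
begin

text \<open>
  Dynamical systems are given by a compact carrier \<open>X\<close> inside a type with its canonical topology or
  metric and a function \<open>f\<close> mapping \<open>X\<close> continuously to itself; the values of \<open>f\<close> outside \<open>X\<close> are
  irrelevant.
\<close>

section \<open>Topological entropy (Adler--Konheim--McAndrew)\<close>

definition open_covers :: "'a::topological_space set \<Rightarrow> 'a set set set" where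
  "open_covers X = {\<U>. (\<forall>U\<in>\<U>. openin (top_of_set X) U) \<and> \<Union>\<U> = X}"

definition cover_number :: "'a set \<Rightarrow> 'a set set \<Rightarrow> nat" where
  "cover_number X \<U> = (LEAST k. \<exists>\<V>\<subseteq>\<U>. finite \<V> \<and> card \<V> = k \<and> X \<subseteq> \<Union>\<V>)"

definition cover_join :: "'a set set \<Rightarrow> 'a set set \<Rightarrow> 'a set set" where
  "cover_join \<U> \<V> = {U \<inter> V | U V. U \<in> \<U> \<and> V \<in> \<V>}"

definition cover_pullback :: "'a set \<Rightarrow> ('a \<Rightarrow> 'a) \<Rightarrow> 'a set set \<Rightarrow> 'a set set" where
  "cover_pullback X f \<U> = {f -` U \<inter> X | U. U \<in> \<U>}"

text \<open>For \<open>n \<ge> 1\<close>, the join of the pullbacks of \<open>\<U>\<close> under the iterates \<open>f ^^ 0, \<dots>, f ^^ (n - 1)\<close>;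
  \<open>{X}\<close> is the neutral element of the join of covers of \<open>X\<close>.\<close>
primrec iterated_join :: "'a set \<Rightarrow> ('a \<Rightarrow> 'a) \<Rightarrow> 'a set set \<Rightarrow> nat \<Rightarrow> 'a set set" where
  "iterated_join X f \<U> 0 = {X}"
| "iterated_join X f \<U> (Suc n) =
     cover_join (iterated_join X f \<U> n) (cover_pullback X (f ^^ n) \<U>)"

text \<open>For compact \<open>X\<close> and continuous \<open>f\<close> the limit exists, by subadditivity.\<close>
definition cover_entropy :: "'a set \<Rightarrow> ('a \<Rightarrow> 'a) \<Rightarrow> 'a set set \<Rightarrow> real" where
  "cover_entropy X f \<U> =
     lim (\<lambda>n. ln (real (cover_number X (iterated_join X f \<U> n))) / real n)"

definition topological_entropy :: "'a::topological_space set \<Rightarrow> ('a \<Rightarrow> 'a) \<Rightarrow> ereal" where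
  "topological_entropy X f = (SUP \<U>\<in>open_covers X. ereal (cover_entropy X f \<U>))"

section \<open>Distributional chaos\<close>

definition xi :: "('a::metric_space \<Rightarrow> 'a) \<Rightarrow> 'a \<Rightarrow> 'a \<Rightarrow> real \<Rightarrow> nat \<Rightarrow> nat" where
  "xi f x y t n = card {i. i < n \<and> dist ((f ^^ i) x) ((f ^^ i) y) < t}"

definition Psi_n :: "('a::metric_space \<Rightarrow> 'a) \<Rightarrow> 'a \<Rightarrow> 'a \<Rightarrow> real \<Rightarrow> nat \<Rightarrow> real" where
  "Psi_n f x y t n = real (xi f x y t n) / real n"

text \<open>The values lie in the unit interval; \<^typ>\<open>ereal\<close> only serves to have \<^const>\<open>liminf\<close> and
  \<^const>\<open>limsup\<close> available.\<close>
definition Psi_lower :: "('a::metric_space \<Rightarrow> 'a) \<Rightarrow> 'a \<Rightarrow> 'a \<Rightarrow> real \<Rightarrow> ereal" where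
  "Psi_lower f x y t = liminf (\<lambda>n. ereal (Psi_n f x y t n))"

definition Psi_upper :: "('a::metric_space \<Rightarrow> 'a) \<Rightarrow> 'a \<Rightarrow> 'a \<Rightarrow> real \<Rightarrow> ereal" where
  "Psi_upper f x y t = limsup (\<lambda>n. ereal (Psi_n f x y t n))"

definition DC2_pair :: "('a::metric_space \<Rightarrow> 'a) \<Rightarrow> 'a \<Rightarrow> 'a \<Rightarrow> bool" where
  "DC2_pair f x y \<longleftrightarrow>
     (\<forall>t>0. Psi_upper f x y t = 1) \<and> (\<exists>t>0. Psi_lower f x y t < Psi_upper f x y t)"

definition DC2_scrambled :: "'a::metric_space set \<Rightarrow> ('a \<Rightarrow> 'a) \<Rightarrow> 'a set \<Rightarrow> bool" where
  "DC2_scrambled X f S \<longleftrightarrow> S \<subseteq> X \<and> (\<forall>x\<in>S. \<forall>y\<in>S. x \<noteq> y \<longrightarrow> DC2_pair f x y)"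

definition DC2_map :: "'a::metric_space set \<Rightarrow> ('a \<Rightarrow> 'a) \<Rightarrow> bool" where
  "DC2_map X f \<longleftrightarrow> (\<exists>S. uncountable S \<and> DC2_scrambled X f S)"

definition DC2_point :: "'a::metric_space set \<Rightarrow> ('a \<Rightarrow> 'a) \<Rightarrow> 'a \<Rightarrow> bool" where
  "DC2_point X f x\<^sub>0 \<longleftrightarrow> x\<^sub>0 \<in> X \<and>
     (\<forall>\<epsilon>>0. \<exists>S n A. uncountable S \<and> DC2_scrambled X f S \<and> n > 0 \<and>
        closedin (top_of_set X) A \<and> S \<subseteq> A \<and>
        A \<subseteq> (f ^^ n) ` A \<and> (f ^^ n) ` A \<subseteq> ball x\<^sub>0 \<epsilon>)"

section \<open>Triangular maps of the square\<close>

definition unit_square :: "(real \<times> real) set" where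
  "unit_square = {0..1} \<times> {0..1}"

text \<open>Continuous dependence of \<open>g x\<close> on \<open>x\<close> is with respect to uniform convergence.\<close>
definition triangular_map :: "(real \<times> real \<Rightarrow> real \<times> real) \<Rightarrow> bool" where
  "triangular_map F \<longleftrightarrow>
     continuous_on unit_square F \<and> F \<in> unit_square \<rightarrow> unit_square \<and>
     (\<exists>f g. continuous_on {0..1} f \<and> f \<in> {0..1} \<rightarrow> {0..1} \<and>
        (\<forall>x\<in>{0..1}. continuous_on {0..1} (g x) \<and> g x \<in> {0..1} \<rightarrow> {0..1} \<and>
                    uniform_limit {0..1} g (g x) (at x within {0..1})) \<and>
        (\<forall>x\<in>{0..1}. \<forall>y\<in>{0..1}. F (x, y) = (f x, g x y)))"

end

theory Submission
  imports Defs
begin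

text \<open>
  The base map is an interval map of type \<open>2\<^sup>\<infinity>\<close> with a wandering interval. Its solenoid is an odometer
  with one orbit of points blown up, so a sign \<open>\<plusminus>1\<close> that jumps across the wandering interval is
  continuous on the solenoid. The fibre maps are odd maps of an interval, multiplied by this sign;
  they are chaotic on two outer parts and attract the middle part to the centre. Close to the wandering
  interval the chaotic parts are squeezed towards a point, and in the gaps next to it they are pushed
  into the middle. Over a backward orbit outside the solenoid all points have fallen into the middle,
  while over the solenoid the forced changes of sign along every arithmetic progression of times
  prevent orbits in the outer parts from staying in a small ball. Hence a set \<open>A\<close> with
  \<open>A \<subseteq> F\<^sup>n(A)\<close> and \<open>F\<^sup>n(A)\<close> in a small ball consists of points eventually on the central line, where the dynamics is that
  of the base, and the base has no DC2-pairs. The squeezing is rare enough for a symbol to be free at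
  half of the times over the orbit of \<open>0\<close>, which gives positive entropy and a scrambled set.
\<close>

section \<open>Entropy of open covers\<close>

text \<open>Chaos can be localised in a small ball in two ways, and each needs its own obstacle.
  Over a periodic base orbit the fibre maps along one period compose to a map of a single interval,
  where a horseshoe would produce sets \<open>A\<close> as in the definition of a DC2-point. These
  orbits pass through the gaps, which accumulate at the ends of the wandering interval; so the
  horseshoes have to be destroyed arbitrarily close to it, and continuity forces a contraction on
  the neighbouring strips \<open>D k\<close> as well. Over the solenoid, a small piece of the
  chaotic part could return under an iterate; this is what the sign excludes. The sign
  \<open>(-1) ^ k\<close> on \<open>D k\<close> has no limit along the strips, so the odometer point
  to which they converge must be replaced by an interval: even strips tend to its left end and odd
  ones to its right end. The two demands are compatible because of the rates. A step expands by 3, a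
  visit to \<open>D k\<close> loses at most the factor 3 to the power \<open>k - 1\<close>, and the
  orbit of 0 visits \<open>D k\<close> with frequency 2 to the power \<open>- (k + 1)\<close>. The
  sum of (k - 1) / 2^(k+1) over k >= 1 is 1/2, so half of the expansion survives.\<close>

lemma Fekete_subadditive:
  fixes a :: "nat \<Rightarrow> real"
  assumes nonneg: "\<And>n. 0 \<le> a n"
    and subadd: "\<And>m n. a (m + n) \<le> a m + a n"
  shows "convergent (\<lambda>n. a n / real n)"
proof -
  define L where "L = Inf ((\<lambda>n. a n / real n) ` {1..})"
  have bdd: "bdd_below ((\<lambda>n. a n / real n) ` {1..})"
    by (rule bdd_belowI[of _ 0]) (auto simp: nonneg)
  have L_le: "L \<le> a n / real n" if "n \<ge> 1" for n
    unfolding L_def using bdd that by (intro cINF_lower) auto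
  have mult: "a (q * m) \<le> real q * a m" if "q \<ge> 1" for q m
    using that
  proof (induction q rule: dec_induct)
    case (step q)
    then show ?case using subadd[of "q * m" m] by (simp add: algebra_simps)
  qed simp
  have "(\<lambda>n. a n / real n) \<longlonglongrightarrow> L"
  proof (rule LIMSEQ_I)
    fix r :: real assume "0 < r"
    have "\<exists>x\<in>(\<lambda>n. a n / real n) ` {1..}. x < L + r / 2"
      using \<open>0 < r\<close> bdd unfolding L_def
      by (subst cInf_less_iff[symmetric]) auto
    then obtain m where m: "m \<ge> 1" "a m / real m < L + r / 2" by auto
    define M where "M = (\<Sum>i<m. a i)"
    have M: "a i \<le> M" if "i < m" for i
      unfolding M_def using that nonneg by (intro member_le_sum) auto
    obtain N where N: "real N > 2 * (a 0 + M) / r" using reals_Archimedean2 by blast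
    show "\<exists>no. \<forall>n\<ge>no. norm (a n / real n - L) < r"
    proof (intro exI[of _ "max (N + 1) m"] allI impI)
      fix n assume n: "n \<ge> max (N + 1) m"
      define q where "q = n div m"
      have q: "q \<ge> 1" using n m by (simp add: q_def div_greater_zero_iff Suc_leI)
      have n_eq: "n = q * m + n mod m" by (simp add: q_def)
      have "n mod m < m" using m by simp
      have "a n \<le> a (q * m) + a (n mod m)" using subadd[of "q * m" "n mod m"] n_eq by simp
      also have "\<dots> \<le> real q * a m + M" using mult[OF q] M[OF \<open>n mod m < m\<close>] by (simp add: add_mono)
      also have "real q * a m \<le> real n * (a m / real m)"
      proof -
        have "q * m \<le> n" using n_eq by linarith
        then have "real q * real m \<le> real n" by (metis of_nat_le_iff of_nat_mult)
        then have "real q * real m * a m \<le> real n * a m" using nonneg by (intro mult_right_mono) auto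
        then show ?thesis using m by (simp add: field_simps)
      qed
      finally have 1: "a n \<le> real n * (a m / real m) + M" by simp
      have npos: "real n > 0" using n m by simp
      have "real n > 2 * (a 0 + M) / r" using N n by linarith
      then have "real n * r > 2 * (a 0 + M)" using \<open>0 < r\<close> by (simp add: field_simps)
      then have "M < real n * (r / 2)" using nonneg[of 0] by simp
      with 1 have "a n < real n * (a m / real m + r / 2)" by (simp add: algebra_simps)
      also have "\<dots> < real n * (L + r)" using m npos by (intro mult_strict_left_mono) auto
      finally have "a n / real n < L + r" using npos by (simp add: field_simps)
      moreover have "L \<le> a n / real n" using n m by (intro L_le) auto
      ultimately show "norm (a n / real n - L) < r" by simp
    qed
  qed
  then show ?thesis by (auto simp: convergent_def)
qed

context
  fixes X :: "'a::topological_space set" and f :: "'a \<Rightarrow> 'a" and \<U> :: "'a set set"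
  assumes X: "compact X" "X \<noteq> {}" and f: "continuous_on X f" "f \<in> X \<rightarrow> X"
    and \<U>: "\<U> \<in> open_covers X"
begin

lemma funpow_in_carrier: "x \<in> X \<Longrightarrow> (f ^^ n) x \<in> X"
  using f(2) by (induction n) auto

lemma continuous_on_funpow_carrier: "continuous_on X (f ^^ n)"
proof (induction n)
  case (Suc n)
  have "continuous_on X (f \<circ> (f ^^ n))"
    by (intro continuous_on_compose Suc continuous_on_subset[OF f(1)]) (auto simp: funpow_in_carrier)
  then show ?case by simp
qed (simp add: id_def)

lemma iterated_join_open_cover: "iterated_join X f \<U> n \<in> open_covers X"
proof (induction n)
  case 0
  then show ?case by (auto simp: open_covers_def)
next
  case (Suc n)
  have "openin (top_of_set X) ((f ^^ n) -` U \<inter> X)" if "U \<in> \<U>" for U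
    using that \<U> continuous_openin_preimage[OF continuous_on_funpow_carrier, of n X U] funpow_in_carrier
    by (auto simp: open_covers_def Int_commute)
  moreover have "\<exists>U\<in>\<U>. (f ^^ n) x \<in> U" if "x \<in> X" for x
    using \<U> funpow_in_carrier[OF that] by (auto simp: open_covers_def)
  moreover have "\<Union>(iterated_join X f \<U> (Suc n)) = X"
  proof (intro equalityI subsetI)
    fix x assume "x \<in> \<Union>(iterated_join X f \<U> (Suc n))"
    then show "x \<in> X" by (auto simp: cover_join_def cover_pullback_def)
  next
    fix x assume x: "x \<in> X"
    obtain U where "U \<in> \<U>" "(f ^^ n) x \<in> U" using calculation(2)[OF x] by blast
    moreover obtain A where "A \<in> iterated_join X f \<U> n" "x \<in> A"
      using Suc x unfolding open_covers_def by blast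
    ultimately show "x \<in> \<Union>(iterated_join X f \<U> (Suc n))" using x
      by (intro UnionI[of "A \<inter> ((f ^^ n) -` U \<inter> X)"]) (auto simp: cover_join_def cover_pullback_def)
  qed
  moreover have "openin (top_of_set X) W" if "W \<in> iterated_join X f \<U> (Suc n)" for W
  proof -
    obtain A U where "A \<in> iterated_join X f \<U> n" "U \<in> \<U>" "W = A \<inter> ((f ^^ n) -` U \<inter> X)"
      using \<open>W \<in> _\<close> by (auto simp: cover_join_def cover_pullback_def)
    then show ?thesis using Suc calculation(1) openin_Int unfolding open_covers_def by blast
  qed
  ultimately show ?case by (simp add: open_covers_def)
qed

lemma cover_number_attained:
  assumes "\<V> \<in> open_covers X"
  shows "\<exists>\<W>\<subseteq>\<V>. finite \<W> \<and> card \<W> = cover_number X \<V> \<and> X \<subseteq> \<Union>\<W>"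
proof -
  have "\<exists>\<W>\<subseteq>\<V>. finite \<W> \<and> X \<subseteq> \<Union>\<W>"
  proof -
    have "(\<forall>U\<in>\<V>. openin (top_of_set X) U) \<and> X \<subseteq> \<Union>\<V>"
      using assms by (auto simp: open_covers_def)
    with X(1)[unfolded compact_eq_openin_cover, rule_format, of \<V>]
    show ?thesis by blast
  qed
  then have "\<exists>k. \<exists>\<W>\<subseteq>\<V>. finite \<W> \<and> card \<W> = k \<and> X \<subseteq> \<Union>\<W>" by blast
  from LeastI_ex[OF this] show ?thesis unfolding cover_number_def by simp
qed

lemma cover_number_le:
  "\<W> \<subseteq> \<V> \<Longrightarrow> finite \<W> \<Longrightarrow> X \<subseteq> \<Union>\<W> \<Longrightarrow> cover_number X \<V> \<le> card \<W>"
  unfolding cover_number_def by (rule Least_le) blast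

lemma cover_number_pos:
  assumes "\<V> \<in> open_covers X" shows "cover_number X \<V> > 0"
proof -
  obtain \<W> where \<W>: "finite \<W>" "card \<W> = cover_number X \<V>" "X \<subseteq> \<Union>\<W>"
    using cover_number_attained[OF assms] by blast
  with X(2) have "\<W> \<noteq> {}" by auto
  with \<W> show ?thesis by (metis card_gt_0_iff)
qed

lemma iterated_join_add:
  assumes "A \<in> iterated_join X f \<U> m" "B \<in> iterated_join X f \<U> n"
  shows "A \<inter> ((f ^^ m) -` B \<inter> X) \<in> iterated_join X f \<U> (m + n)"
  using assms(2)
proof (induction n arbitrary: B)
  case 0
  have "A \<subseteq> X" using iterated_join_open_cover[of m] assms(1) unfolding open_covers_def by blast
  then have "A \<inter> ((f ^^ m) -` B \<inter> X) = A" using 0 funpow_in_carrier by auto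
  then show ?case using assms(1) by simp
next
  case (Suc n)
  then obtain B' U where B: "B' \<in> iterated_join X f \<U> n" "U \<in> \<U>" "B = B' \<inter> ((f ^^ n) -` U \<inter> X)"
    by (auto simp: cover_join_def cover_pullback_def)
  have "A \<inter> ((f ^^ m) -` B \<inter> X) = (A \<inter> ((f ^^ m) -` B' \<inter> X)) \<inter> ((f ^^ (m + n)) -` U \<inter> X)"
    using funpow_in_carrier by (auto simp: B(3) funpow_add add.commute[of m n])
  then show ?case using Suc.IH[OF B(1)] B(2)
    by (auto simp: cover_join_def cover_pullback_def)
qed

lemma cover_number_submult:
  "cover_number X (iterated_join X f \<U> (m + n))
     \<le> cover_number X (iterated_join X f \<U> m) * cover_number X (iterated_join X f \<U> n)"
proof -
  obtain \<V> where \<V>: "\<V> \<subseteq> iterated_join X f \<U> m" "finite \<V>" "card \<V> = cover_number X (iterated_join X f \<U> m)"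
    "X \<subseteq> \<Union>\<V>"
    using cover_number_attained[OF iterated_join_open_cover] by meson
  obtain \<W> where \<W>: "\<W> \<subseteq> iterated_join X f \<U> n" "finite \<W>" "card \<W> = cover_number X (iterated_join X f \<U> n)"
    "X \<subseteq> \<Union>\<W>"
    using cover_number_attained[OF iterated_join_open_cover] by meson
  define \<Z> where "\<Z> = (\<lambda>(A, B). A \<inter> ((f ^^ m) -` B \<inter> X)) ` (\<V> \<times> \<W>)"
  have "\<Z> \<subseteq> iterated_join X f \<U> (m + n)"
    using \<V>(1) \<W>(1) iterated_join_add by (fastforce simp: \<Z>_def)
  moreover have "X \<subseteq> \<Union>\<Z>"
  proof
    fix x assume x: "x \<in> X"
    obtain A B where "A \<in> \<V>" "x \<in> A" "B \<in> \<W>" "(f ^^ m) x \<in> B"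
      using \<V>(4) \<W>(4) x funpow_in_carrier[OF x, of m] by blast
    then show "x \<in> \<Union>\<Z>" using x unfolding \<Z>_def by (intro UnionI[of "A \<inter> ((f ^^ m) -` B \<inter> X)"]) auto
  qed
  moreover have "finite \<Z>" using \<V>(2) \<W>(2) by (simp add: \<Z>_def)
  ultimately have "cover_number X (iterated_join X f \<U> (m + n)) \<le> card \<Z>" by (intro cover_number_le)
  also have "\<dots> \<le> card (\<V> \<times> \<W>)" unfolding \<Z>_def using \<V>(2) \<W>(2) by (intro card_image_le) auto
  finally show ?thesis using \<V> \<W> by (simp add: card_cartesian_product)
qed

text \<open>The entropy of a cover is a \<open>lim\<close>, about which bounds on the terms say
  nothing until convergence is known. Submultiplicativity of the cover numbers and
  \<open>Fekete_subadditive\<close> supply it.\<close>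

lemma cover_entropy_ge:
  assumes "\<And>n. n \<ge> 1 \<Longrightarrow> h * real n \<le> ln (real (cover_number X (iterated_join X f \<U> n)))"
  shows "cover_entropy X f \<U> \<ge> h"
proof -
  let ?N = "\<lambda>n. cover_number X (iterated_join X f \<U> n)"
  have pos: "?N n > 0" for n by (rule cover_number_pos[OF iterated_join_open_cover])
  have "convergent (\<lambda>n. ln (real (?N n)) / real n)"
  proof (rule Fekete_subadditive)
    show "0 \<le> ln (real (?N n))" for n using pos[of n] by simp
    show "ln (real (?N (m + n))) \<le> ln (real (?N m)) + ln (real (?N n))" for m n
    proof -
      have "real (?N (m + n)) \<le> real (?N m) * real (?N n)"
        using cover_number_submult[of m n] by (metis of_nat_le_iff of_nat_mult)
      then have "ln (real (?N (m + n))) \<le> ln (real (?N m) * real (?N n))"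
        using pos by (subst ln_le_cancel_iff) auto
      also have "\<dots> = ln (real (?N m)) + ln (real (?N n))" using pos by (simp add: ln_mult)
      finally show ?thesis .
    qed
  qed
  then have "(\<lambda>n. ln (real (?N n)) / real n) \<longlonglongrightarrow> cover_entropy X f \<U>"
    unfolding cover_entropy_def by (simp add: convergent_LIMSEQ_iff)
  moreover have "\<forall>n\<ge>1. h \<le> ln (real (?N n)) / real n"
    using assms by (auto simp: field_simps)
  ultimately show ?thesis by (intro LIMSEQ_le_const) auto
qed

end

text \<open>Used contrapositively: two points whose images at some time below \<open>n\<close> share
  no member of the cover need different cells of the join.\<close>

lemma iterated_join_same_cell:
  assumes "W \<in> iterated_join X f \<U> n" "p \<in> W" "q \<in> W" "t < n"
  shows "\<exists>U\<in>\<U>. (f ^^ t) p \<in> U \<and> (f ^^ t) q \<in> U"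
  using assms
proof (induction n arbitrary: W)
  case (Suc n)
  then show ?case
    by (cases "t = n") (auto simp: cover_join_def cover_pullback_def)
qed simp

section \<open>The base map\<close>

text \<open>Chosen so that the product of the \<open>1 - hi j\<close> over \<open>j < k\<close>,
  which is the length of \<open>J k\<close>, telescopes to 1/2 + (1/2)^k / 2 (see
  \<open>one_minus_hi\<close>) and stays above 1/2.\<close>

definition hi :: "nat \<Rightarrow> real" where "hi k = 1 / (2 ^ Suc k + 2)"
definition lo :: "nat \<Rightarrow> real" where "lo k = hi k / 2"

lemma hi_pos: "hi k > 0" by (simp add: hi_def add_pos_pos)
lemma hi_le: "hi k \<le> 1/4"
proof -
  have "(1::real) \<le> 2 ^ k" by simp
  then have "1 / (2 ^ Suc k + 2) \<le> 1 / (4::real)" by (intro divide_left_mono) (auto simp: add_pos_pos)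
  then show ?thesis by (simp add: hi_def)
qed
lemma lo_pos: "lo k > 0" and lo_less_hi: "lo k < hi k" and lo_le: "lo k \<le> 1/8"
  using hi_pos[of k] hi_le[of k] by (auto simp: lo_def)

lemmas lo_hi = hi_pos hi_le lo_pos lo_less_hi lo_le

text \<open>The limit maps are of period doubling type: \<open>tower_map k\<close> exchanges \<open>{0..lo k}\<close> and
  \<open>{hi k..1}\<close>, and its square on \<open>{hi k..1}\<close> is an orientation reversing affine copy of
  \<open>tower_map (Suc k)\<close>. As \<open>hi k\<close> is summable, the renormalisation intervals shrink to the
  nondegenerate interval from \<open>1/3\<close> to \<open>5/6\<close>.\<close>
fun approx_map :: "nat \<Rightarrow> nat \<Rightarrow> real \<Rightarrow> real" where
  "approx_map 0 k z = 1 - (1 - lo k) * z"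
| "approx_map (Suc N) k z =
     (if z \<le> lo k then 1 - (1 - hi k) * z / lo k
      else if z \<le> hi k then hi k - (hi k - lo k * lo (Suc k)) * (z - lo k) / (hi k - lo k)
      else lo k * approx_map N (Suc k) ((1 - z) / (1 - hi k)))"

lemma approx_map_0: "approx_map N k 0 = 1"
  using lo_hi[of k] by (cases N) auto

text \<open>This value at 1 is independent of \<open>N\<close>, and the gap branch ends in
  \<open>lo k * lo (Suc k)\<close>; so the last two branches of the recursion agree at
  \<open>hi k\<close>.\<close>

lemma approx_map_1: "approx_map N k 1 = lo k"
  using lo_hi[of k] by (cases N) (auto simp: approx_map_0)

lemma rescale_range:
  assumes "hi k \<le> z" "z \<le> 1"
  shows "(1 - z) / (1 - hi k) \<in> {0..1}"
  using assms lo_hi[of k] by (auto simp: divide_simps)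

lemma low_range:
  assumes "0 \<le> z" "z \<le> lo k"
  shows "1 - (1 - hi k) * z / lo k \<in> {hi k..1}"
proof -
  have "(1 - hi k) * (z / lo k) \<le> (1 - hi k) * 1"
    using assms lo_hi[of k] by (intro mult_left_mono) auto
  moreover have "0 \<le> (1 - hi k) * (z / lo k)" using assms lo_hi[of k] by simp
  ultimately show ?thesis by simp
qed

lemma gap_range:
  assumes "lo k \<le> z" "z \<le> hi k"
  shows "hi k - (hi k - lo k * lo (Suc k)) * (z - lo k) / (hi k - lo k) \<in> {0..hi k}"
proof -
  have "lo k * lo (Suc k) \<le> hi k * 1"
    using lo_hi[of k] lo_hi[of "Suc k"] by (intro mult_mono) auto
  then have *: "0 \<le> hi k - lo k * lo (Suc k)" by simp
  have "(hi k - lo k * lo (Suc k)) * ((z - lo k) / (hi k - lo k)) \<le> (hi k - lo k * lo (Suc k)) * 1"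
    using assms lo_hi[of k] * by (intro mult_left_mono) auto
  moreover have "0 \<le> (hi k - lo k * lo (Suc k)) * ((z - lo k) / (hi k - lo k))"
    using assms lo_hi[of k] * by simp
  moreover have "0 \<le> lo k * lo (Suc k)" using lo_pos by (simp add: less_imp_le)
  ultimately show ?thesis by simp
qed

lemma approx_map_range: "z \<in> {0..1} \<Longrightarrow> approx_map N k z \<in> {0..1}"
proof (induction N arbitrary: k z)
  case 0
  have "(1 - lo k) * z \<le> 1 * 1" using 0 lo_hi[of k] by (intro mult_mono) auto
  then show ?case using 0 lo_hi[of k] by simp
next
  case (Suc N)
  consider "z \<le> lo k" | "lo k < z" "z \<le> hi k" | "hi k < z" by linarith
  then show ?case
  proof cases
    case 1
    then have "approx_map (Suc N) k z = 1 - (1 - hi k) * z / lo k" by simp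
    also have "\<dots> \<in> {hi k..1}" using 1 Suc.prems by (intro low_range) auto
    finally show ?thesis using hi_pos[of k] by (simp del: approx_map.simps)
  next
    case 2
    then show ?thesis using gap_range[of k z] lo_hi[of k] by auto
  next
    case 3
    have "approx_map N (Suc k) ((1 - z) / (1 - hi k)) \<in> {0..1}"
      using 3 Suc.prems by (intro Suc.IH rescale_range) auto
    then have "lo k * approx_map N (Suc k) ((1 - z) / (1 - hi k)) \<le> 1 * 1"
      using lo_hi[of k] by (intro mult_mono) auto
    then show ?thesis using 3 \<open>approx_map N _ _ \<in> _\<close> lo_hi[of k] by auto
  qed
qed

lemma continuous_on_approx_map: "continuous_on {0..1} (approx_map N k)"
proof (induction N arbitrary: k)
  case 0
  then show ?case by (auto intro!: continuous_intros simp: approx_map.simps[abs_def])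
next
  case (Suc N)
  have eq: "approx_map (Suc N) k = (\<lambda>z. if z \<le> lo k then 1 - (1 - hi k) * z / lo k
      else if z \<le> hi k then hi k - (hi k - lo k * lo (Suc k)) * (z - lo k) / (hi k - lo k)
      else lo k * approx_map N (Suc k) ((1 - z) / (1 - hi k)))" by auto
  have 1: "continuous_on {hi k..1} (\<lambda>z. lo k * approx_map N (Suc k) ((1 - z) / (1 - hi k)))"
    using rescale_range lo_hi[of k]
    by (intro continuous_intros continuous_on_compose2[OF Suc]) auto
  have 2: "continuous_on {lo k..1} (\<lambda>z. if z \<le> hi k then hi k - (hi k - lo k * lo (Suc k)) * (z - lo k) / (hi k - lo k)
      else lo k * approx_map N (Suc k) ((1 - z) / (1 - hi k)))"
    apply (rule continuous_on_subset[of "{lo k..hi k} \<union> {hi k..1}"])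
     apply (rule continuous_on_If)
    using 1 lo_hi[of k] by (auto intro!: continuous_intros simp: approx_map_1)
  show ?case unfolding eq
    apply (rule continuous_on_subset[of "{0..lo k} \<union> {lo k..1}"])
     apply (rule continuous_on_If)
    using 2 lo_hi[of k] by (auto intro!: continuous_intros)
qed

text \<open>Only the branch above \<open>hi k\<close> depends on \<open>N\<close>, and it multiplies
  the difference one level down by \<open>lo k\<close>, which is at most 1/8.\<close>

lemma approx_map_diff:
  "z \<in> {0..1} \<Longrightarrow> \<bar>approx_map (Suc N) k z - approx_map N k z\<bar> \<le> (1/2) ^ N"
proof (induction N arbitrary: k z)
  case 0
  then show ?case using approx_map_range[OF 0, of "Suc 0" k] approx_map_range[OF 0, of 0 k] by (auto simp del: approx_map.simps)
next
  case (Suc N)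
  show ?case
  proof (cases "z \<le> hi k")
    case True
    then show ?thesis by simp
  next
    case False
    let ?z = "(1 - z) / (1 - hi k)"
    have "\<bar>approx_map (Suc (Suc N)) k z - approx_map (Suc N) k z\<bar>
        = lo k * \<bar>approx_map (Suc N) (Suc k) ?z - approx_map N (Suc k) ?z\<bar>"
      using False lo_hi[of k] by (simp add: right_diff_distrib[symmetric] abs_mult del: approx_map.simps(2) add: approx_map.simps(2)[of _ k])
    also have "\<dots> \<le> 1/2 * (1/2) ^ N"
      using False Suc.prems lo_hi[of k] by (intro mult_mono Suc.IH rescale_range) auto
    finally show ?thesis by simp
  qed
qed

text \<open>A telescoping series with partial sums \<open>approx_map N k\<close>; in this form the
  Weierstrass test gives uniform convergence.\<close>

definition tower_map :: "nat \<Rightarrow> real \<Rightarrow> real" where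
  "tower_map k z = approx_map 0 k z + (\<Sum>N. approx_map (Suc N) k z - approx_map N k z)"

lemma uniform_limit_tower_map:
  "uniform_limit {0..1} (\<lambda>N. approx_map N k) (tower_map k) sequentially"
proof -
  have "uniform_limit {0..1} (\<lambda>n x. \<Sum>i<n. approx_map (Suc i) k x - approx_map i k x)
      (\<lambda>x. \<Sum>i. approx_map (Suc i) k x - approx_map i k x) sequentially"
    by (rule Weierstrass_m_test[of _ _ "\<lambda>N. (1/2) ^ N"]) (use approx_map_diff in auto)
  then have "uniform_limit {0..1} (\<lambda>n x. approx_map 0 k x + (\<Sum>i<n. approx_map (Suc i) k x - approx_map i k x))
     (\<lambda>x. approx_map 0 k x + (\<Sum>i. approx_map (Suc i) k x - approx_map i k x)) sequentially"
    by (intro uniform_limit_intros)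
  moreover have "approx_map 0 k x + (\<Sum>i<n. approx_map (Suc i) k x - approx_map i k x) = approx_map n k x" for n x
    using sum_lessThan_telescope[of "\<lambda>i. approx_map i k x" n] by linarith
  ultimately show ?thesis unfolding tower_map_def[abs_def] by (simp only:)
qed

lemma continuous_on_tower_map: "continuous_on {0..1} (tower_map k)"
  by (rule uniform_limit_theorem[OF _ uniform_limit_tower_map])
     (auto intro!: always_eventually continuous_on_approx_map)

lemma tower_map_LIMSEQ: "z \<in> {0..1} \<Longrightarrow> (\<lambda>N. approx_map N k z) \<longlonglongrightarrow> tower_map k z"
  using tendsto_uniform_limitI[OF uniform_limit_tower_map] .

lemma tower_map_range:
  assumes "z \<in> {0..1}" shows "tower_map k z \<in> {0..1}"
  by (rule closed_sequentially[OF _ _ tower_map_LIMSEQ[OF assms]])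
     (auto simp: approx_map_range[OF assms, simplified] simp del: approx_map.simps)

lemma tower_map_low:
  assumes "0 \<le> z" "z \<le> lo k" shows "tower_map k z = 1 - (1 - hi k) * z / lo k"
proof -
  have "(\<lambda>N. approx_map (Suc N) k z) \<longlonglongrightarrow> tower_map k z"
    using assms lo_hi[of k] by (intro LIMSEQ_Suc tower_map_LIMSEQ) auto
  then show ?thesis using assms by (simp add: LIMSEQ_const_iff)
qed

lemma tower_map_gap:
  assumes "lo k \<le> z" "z \<le> hi k"
  shows "tower_map k z = hi k - (hi k - lo k * lo (Suc k)) * (z - lo k) / (hi k - lo k)"
proof (cases "z = lo k")
  case True
  then show ?thesis using lo_hi[of k] by (simp add: tower_map_low)
next
  case False
  have "(\<lambda>N. approx_map (Suc N) k z) \<longlonglongrightarrow> tower_map k z"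
    using assms lo_hi[of k] by (intro LIMSEQ_Suc tower_map_LIMSEQ) auto
  then show ?thesis using assms False by (simp add: LIMSEQ_const_iff)
qed

lemma tower_map_0: "tower_map k 0 = 1"
  using lo_hi[of k] by (simp add: tower_map_low)

lemma tower_map_1: "tower_map k 1 = lo k"
  using tower_map_LIMSEQ[of 1 k] by (simp add: approx_map_1 LIMSEQ_const_iff)

lemma tower_map_high:
  assumes "hi k \<le> z" "z \<le> 1"
  shows "tower_map k z = lo k * tower_map (Suc k) ((1 - z) / (1 - hi k))"
proof (cases "z = hi k")
  case True
  then show ?thesis using lo_hi[of k] by (simp add: tower_map_gap tower_map_1)
next
  case False
  have "(\<lambda>N. approx_map (Suc N) k z) \<longlonglongrightarrow> tower_map k z"
    using assms lo_hi[of k] by (intro LIMSEQ_Suc tower_map_LIMSEQ) auto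
  moreover have "(\<lambda>N. lo k * approx_map N (Suc k) ((1 - z) / (1 - hi k)))
      \<longlonglongrightarrow> lo k * tower_map (Suc k) ((1 - z) / (1 - hi k))"
    using assms by (intro tendsto_intros tower_map_LIMSEQ rescale_range)
  moreover have "approx_map (Suc N) k z = lo k * approx_map N (Suc k) ((1 - z) / (1 - hi k))" for N
    using assms False lo_hi[of k] by auto
  ultimately show ?thesis using LIMSEQ_unique by (simp del: approx_map.simps)
qed

lemma tower_map_low_range: "0 \<le> z \<Longrightarrow> z \<le> lo k \<Longrightarrow> tower_map k z \<in> {hi k..1}"
  using low_range by (simp add: tower_map_low)

lemma tower_map_high_range:
  assumes "hi k \<le> z" "z \<le> 1" shows "tower_map k z \<in> {0..lo k}"
proof -
  have "tower_map (Suc k) ((1 - z) / (1 - hi k)) \<in> {0..1}"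
    using assms by (intro tower_map_range rescale_range)
  then show ?thesis using assms lo_hi[of k] by (simp add: tower_map_high mult_left_le)
qed

lemma rescale_inverse_range:
  assumes "z \<in> {0..1}"
  shows "1 - (1 - hi k) * z \<in> {hi k..1}"
proof -
  have "(1 - hi k) * z \<le> (1 - hi k) * 1" "0 \<le> (1 - hi k) * z"
    using assms lo_hi[of k] by (auto intro: mult_left_mono)
  then show ?thesis by simp
qed

text \<open>The factor \<open>lo k\<close> of the branch above \<open>hi k\<close> is cancelled by
  the division by \<open>lo k\<close> in the branch below \<open>lo k\<close>, so two steps leave
  only the affine change of coordinates.\<close>

lemma tower_map_renorm:
  assumes "z \<in> {0..1}"
  shows "tower_map k (tower_map k (1 - (1 - hi k) * z)) = 1 - (1 - hi k) * tower_map (Suc k) z"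
proof -
  have "tower_map k (1 - (1 - hi k) * z) = lo k * tower_map (Suc k) z"
    using rescale_inverse_range[OF assms, of k] lo_hi[of k] by (subst tower_map_high) auto
  moreover have "tower_map (Suc k) z \<in> {0..1}" by (rule tower_map_range[OF assms])
  ultimately show ?thesis using lo_hi[of k] by (simp add: tower_map_low mult_left_le)
qed

text \<open>The affine chart of the interval \<open>J\<^sub>k\<close> of the tower; it is orientation preserving for even
  \<open>k\<close> and reversing for odd \<open>k\<close>, so that the strips \<open>D\<^sub>k\<close> removed from \<open>J\<^sub>k\<close> lie alternately
  to the left of \<open>1/3\<close> and to the right of \<open>5/6\<close>.\<close>
definition chart :: "nat \<Rightarrow> real \<Rightarrow> real" where
  "chart k z = (if even k then 1/3 - (1/2)^k / 3 + (1/2 + (1/2)^k / 2) * z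
                else 5/6 + (1/2)^k / 3 - (1/2 + (1/2)^k / 2) * z)"

lemma chart_0: "chart 0 z = z" by (simp add: chart_def)

lemma one_minus_hi: "(1/2 + (1/2)^k / 2) * (1 - hi k) = 1/2 + (1/2) ^ Suc k / 2"
proof -
  define u :: real where "u = 2 ^ k"
  have "u > 0" by (simp add: u_def)
  have "hi k = 1 / (2 * u + 2)" "(1/2)^k = 1 / u" "(1/2) ^ Suc k = 1 / (2 * u)"
    by (simp_all add: hi_def u_def power_divide)
  then show ?thesis using \<open>u > 0\<close> by (simp add: divide_simps) (simp add: algebra_simps)?
qed

lemma chart_Suc: "chart (Suc k) z = chart k (1 - (1 - hi k) * z)"
proof -
  have "(1/2 + (1/2)^k / 2) * (1 - (1 - hi k) * z) = (1/2 + (1/2)^k / 2) - (1/2 + (1/2) ^ Suc k / 2) * z"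
  proof -
    have "c * (1 - r * z) = c - c * r * z" for c r :: real by (simp add: algebra_simps)
    then show ?thesis by (metis one_minus_hi)
  qed
  then show ?thesis by (cases "even k") (simp_all add: chart_def algebra_simps)
qed

lemma chart_dist: "\<bar>chart k z - chart k z'\<bar> = (1/2 + (1/2)^k / 2) * \<bar>z - z'\<bar>"
proof -
  have "chart k z - chart k z' = (if even k then 1 else -1) * ((1/2 + (1/2)^k / 2) * (z - z'))"
    by (cases "even k") (simp_all add: chart_def diff_divide_distrib algebra_simps)
  moreover have "(0::real) \<le> 1/2 + (1/2)^k / 2" by simp
  ultimately show ?thesis by (auto simp: abs_mult)
qed

lemma chart_inj: "chart k z = chart k z' \<longleftrightarrow> z = z'"
proof -
  have "(0::real) < 1/2 + (1/2)^k / 2" by (simp add: add_pos_pos)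
  then show ?thesis using chart_dist[of k z z'] by auto
qed

lemma continuous_on_chart: "continuous_on A (chart k)"
  unfolding chart_def by (cases "even k") (auto intro!: continuous_intros)

section \<open>Nested intervals, strips and return times\<close>

abbreviation base :: "real \<Rightarrow> real" where "base \<equiv> tower_map 0"

definition J :: "nat \<Rightarrow> real set" where "J k = chart k ` {0..1}"
definition D :: "nat \<Rightarrow> real set" where "D k = chart k ` {0..lo k}"

lemma J_0: "J 0 = {0..1}" by (simp add: J_def chart_0)

lemma rescale_image: "(\<lambda>z. 1 - (1 - hi k) * z) ` {0..1} = {hi k..1}"
proof (intro equalityI subsetI)
  fix z assume z: "z \<in> {hi k..1}"
  have "z = 1 - (1 - hi k) * ((1 - z) / (1 - hi k))" using lo_hi[of k] by simp
  then show "z \<in> (\<lambda>z. 1 - (1 - hi k) * z) ` {0..1}"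
    using rescale_range[of k z] z by (intro image_eqI[where x = "(1 - z) / (1 - hi k)"]) auto
next
  fix y assume "y \<in> (\<lambda>z. 1 - (1 - hi k) * z) ` {0..1}"
  then show "y \<in> {hi k..1}" using rescale_inverse_range by blast
qed

lemma J_Suc: "J (Suc k) = chart k ` {hi k..1}"
  unfolding J_def rescale_image[symmetric] image_image by (simp add: chart_Suc)

lemma J_Suc_subset: "J (Suc k) \<subseteq> J k"
  unfolding J_Suc unfolding J_def using lo_hi[of k] by (intro image_mono) auto

lemma J_mono: "j \<le> k \<Longrightarrow> J k \<subseteq> J j"
  by (induction rule: dec_induct) (use J_Suc_subset in auto)

lemma D_subset_J: "D k \<subseteq> J k"
  using lo_hi[of k] by (auto simp: D_def J_def)

lemma D_J_disjoint: "D k \<inter> J (Suc k) = {}"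
  using lo_hi[of k] by (auto simp: D_def J_Suc chart_inj)

lemma compact_J: "compact (J k)" unfolding J_def
  by (intro compact_continuous_image continuous_on_chart) auto

lemma compact_D: "compact (D k)" unfolding D_def
  by (intro compact_continuous_image continuous_on_chart) auto

lemma base_chart:
  "z \<in> {0..1} \<Longrightarrow> (base ^^ (2 ^ k)) (chart k z) = chart k (tower_map k z)"
proof (induction k arbitrary: z)
  case 0
  then show ?case by (simp add: chart_0)
next
  case (Suc k)
  let ?w = "1 - (1 - hi k) * z"
  have w: "?w \<in> {0..1}" using rescale_inverse_range[OF Suc.prems, of k] lo_hi[of k] by auto
  have "(base ^^ (2 ^ Suc k)) (chart (Suc k) z) = (base ^^ (2 ^ k)) ((base ^^ (2 ^ k)) (chart k ?w))"
    by (simp add: chart_Suc funpow_add mult_2)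
  also have "\<dots> = chart k (tower_map k (tower_map k ?w))"
    using Suc.IH w tower_map_range by simp
  also have "\<dots> = chart (Suc k) (tower_map (Suc k) z)"
    using Suc.prems by (simp add: tower_map_renorm chart_Suc)
  finally show ?case .
qed

lemma base_D: "x \<in> D k \<Longrightarrow> (base ^^ (2 ^ k)) x \<in> J (Suc k)"
  using tower_map_low_range[of _ k] lo_hi[of k] by (auto simp: D_def J_Suc base_chart)

lemma base_J_Suc: "x \<in> J (Suc k) \<Longrightarrow> (base ^^ (2 ^ k)) x \<in> D k"
  using tower_map_high_range[of k] lo_hi[of k] by (fastforce simp: D_def J_Suc base_chart)

lemma base_J: "x \<in> J k \<Longrightarrow> (base ^^ (2 ^ k)) x \<in> J k"
  using tower_map_range[of _ k] by (auto simp: J_def base_chart)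

lemma base_J_mult: "x \<in> J k \<Longrightarrow> 2 ^ k dvd i \<Longrightarrow> (base ^^ i) x \<in> J k"
proof -
  assume x: "x \<in> J k" and "2 ^ k dvd i"
  then obtain m where i: "i = 2 ^ k * m" by blast
  have "(base ^^ (2 ^ k * m)) x \<in> J k"
    by (induction m) (auto simp: x funpow_add base_J)
  then show ?thesis by (simp add: i)
qed

text \<open>Odd multiples of \<open>2 ^ k\<close> lead from \<open>J (Suc k)\<close> into
  \<open>D k\<close>, which is disjoint from it. Thus \<open>J k\<close> behaves like a cylinder of
  the dyadic odometer.\<close>

lemma base_return:
  "x \<in> J k \<Longrightarrow> (base ^^ i) x \<in> J k \<longleftrightarrow> 2 ^ k dvd i"
proof (induction k)
  case 0
  then show ?case using base_J_mult[of x 0 i] by simp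
next
  case (Suc k)
  show ?case
  proof
    assume i: "(base ^^ i) x \<in> J (Suc k)"
    then have "2 ^ k dvd i" using Suc J_Suc_subset by blast
    then obtain m where m: "i = 2 ^ k * m" by blast
    have "even m"
    proof (rule ccontr)
      assume "odd m"
      then obtain l where "m = 2 * l + 1" by (auto elim: oddE)
      then have "i = 2 ^ k + 2 ^ Suc k * l" by (simp add: m algebra_simps)
      then have "(base ^^ i) x = (base ^^ (2 ^ k)) ((base ^^ (2 ^ Suc k * l)) x)"
        by (simp only: funpow_add comp_apply)
      then have "(base ^^ i) x \<in> D k" using base_J_Suc base_J_mult[OF Suc.prems] by simp
      then show False using i D_J_disjoint by blast
    qed
    then show "2 ^ Suc k dvd i" by (auto simp: m)
  qed (rule base_J_mult[OF Suc.prems])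
qed

lemma base_range: "x \<in> {0..1} \<Longrightarrow> (base ^^ i) x \<in> {0..1}"
  using base_J_mult[of x 0 i] by (simp add: J_0)

section \<open>Pairs of base orbits\<close>

lemma funpow_split: "s \<le> i \<Longrightarrow> (f ^^ i) y = (f ^^ (i - s)) ((f ^^ s) y)"
  by (metis comp_apply funpow_add le_add_diff_inverse2)

lemma mod_power2_less: "n mod 2 ^ k < (2 ^ k :: nat)"
  by simp

lemma residue_in_window:
  fixes t0 t q :: nat
  assumes "t0 \<le> t" "q > 0"
  shows "\<exists>i\<in>{t..<t + q}. q dvd i - t0"
proof -
  define r where "r = (t - t0) mod q"
  have eq: "(t - t0) div q * q + r = t - t0" by (simp add: r_def)
  have "r < q" using assms by (simp add: r_def)
  show ?thesis
  proof (cases "r = 0")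
    case True
    then show ?thesis using assms by (intro bexI[of _ t]) (auto simp: r_def)
  next
    case False
    have "t + (q - r) - t0 = (t - t0) div q * q + q"
      using assms \<open>r < q\<close> eq by linarith
    then have "q dvd t + (q - r) - t0" by simp
    then show ?thesis using False \<open>r < q\<close> by (intro bexI[of _ "t + (q - r)"]) auto
  qed
qed

lemma continuous_on_base_funpow: "continuous_on {0..1} (base ^^ i)"
proof (induction i)
  case (Suc i)
  have "continuous_on {0..1} (base \<circ> (base ^^ i))"
    by (intro continuous_on_compose Suc continuous_on_subset[OF continuous_on_tower_map])
      (use base_range in auto)
  then show ?case by simp
qed (simp add: id_def)

lemma J_subset_unit: "J k \<subseteq> {0..1}" using J_mono[of 0 k] by (simp add: J_0)

lemma compact_base_J: "compact ((base ^^ i) ` J k)"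
  by (intro compact_continuous_image continuous_on_subset[OF continuous_on_base_funpow] J_subset_unit compact_J)

text \<open>A common point, pushed forward by \<open>2 ^ k - j\<close> more steps, would give a
  return to \<open>J k\<close> after a time strictly between 0 and \<open>2 ^ k\<close>.\<close>

lemma funpow_images_J_disjoint:
  assumes "i < j" "j < 2 ^ k"
  shows "(base ^^ i) ` J k \<inter> (base ^^ j) ` J k = {}"
proof (rule ccontr)
  assume "\<not> ?thesis"
  then obtain w w' where w: "w \<in> J k" "w' \<in> J k" "(base ^^ i) w = (base ^^ j) w'" by blast
  have "(base ^^ (2 ^ k - j + i)) w = (base ^^ (2 ^ k - j)) ((base ^^ j) w')"
    using w(3) by (simp add: funpow_add)
  also have "\<dots> = (base ^^ (2 ^ k)) w'"
    using assms by (simp flip: funpow_add comp_apply[of "base ^^ _" "base ^^ _"])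
  finally have "(base ^^ (2 ^ k - j + i)) w \<in> J k" using base_J w by simp
  then have "2 ^ k dvd 2 ^ k - j + i" using base_return w by blast
  then show False using assms nat_dvd_not_less[of "2 ^ k - j + i" "2 ^ k"] by linarith
qed

lemma connected_J: "connected (J k)" unfolding J_def
  by (intro connected_continuous_image continuous_on_chart) auto

text \<open>The segments joining the two orbits lie in the pairwise disjoint images of
  \<open>J k\<close>, so their total length is at most that of the unit interval. The average
  distance over such a block is at most (1/2)^k.\<close>

lemma sum_dist_tower_le:
  assumes "u \<in> J k" "u' \<in> J k"
  shows "(\<Sum>i<2 ^ k. \<bar>(base ^^ i) u - (base ^^ i) u'\<bar>) \<le> 1"
proof -
  define S where "S i = closed_segment ((base ^^ i) u) ((base ^^ i) u')" for i
  have S: "S i \<subseteq> (base ^^ i) ` J k" for i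
  proof -
    have "connected ((base ^^ i) ` J k)"
      by (intro connected_continuous_image continuous_on_subset[OF continuous_on_base_funpow] J_subset_unit connected_J)
    then show ?thesis unfolding S_def is_interval_connected_1[symmetric] is_interval_convex_1
      using assms by (intro closed_segment_subset) auto
  qed
  have disj: "disjoint_family_on S {..<2 ^ k}"
    unfolding disjoint_family_on_def
  proof (intro ballI impI)
    fix i j :: nat assume ij: "i \<in> {..<2 ^ k}" "j \<in> {..<2 ^ k}" "i \<noteq> j"
    have "(base ^^ i) ` J k \<inter> (base ^^ j) ` J k = {}"
    proof (cases "i < j")
      case True
      then show ?thesis using ij by (intro funpow_images_J_disjoint) auto
    next
      case False
      then have "(base ^^ j) ` J k \<inter> (base ^^ i) ` J k = {}" using ij by (intro funpow_images_J_disjoint) auto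
      then show ?thesis by blast
    qed
    then show "S i \<inter> S j = {}" using S[of i] S[of j] by auto
  qed
  have meas: "S i \<in> sets lborel" "emeasure lborel (S i) = ennreal \<bar>(base ^^ i) u - (base ^^ i) u'\<bar>" for i
    by (auto simp: S_def closed_segment_eq_real_ivl)
  have "(\<Sum>i<2 ^ k. measure lborel (S i)) = measure lborel (\<Union>i<2 ^ k. S i)"
    using meas by (intro measure_finite_Union[symmetric] disj) auto
  also have "\<dots> \<le> measure lborel {0..1::real}"
  proof (rule measure_mono_fmeasurable)
    have "(base ^^ i) ` J k \<subseteq> {0..1}" for i using J_subset_unit base_range by blast
    then show "(\<Union>i<2 ^ k. S i) \<subseteq> {0..1}" using S by blast
  qed (use meas in \<open>auto simp: fmeasurable_def\<close>)
  finally show ?thesis using meas by (simp add: measure_def)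
qed

section \<open>Two ways for a pair to fail to be DC2\<close>

definition syndetic_far :: "(nat \<Rightarrow> real) \<Rightarrow> bool" where
  "syndetic_far d \<longleftrightarrow> (\<exists>c>0. \<exists>P>0. \<exists>N. \<forall>t\<ge>N. \<exists>i\<in>{t..<t + P}. c \<le> d i)"

definition rarely_far :: "(nat \<Rightarrow> real) \<Rightarrow> bool" where
  "rarely_far d \<longleftrightarrow> (\<forall>c>0. (\<lambda>n. real (card {i. i < n \<and> c \<le> d i}) / real n) \<longlonglongrightarrow> 0)"

lemma Psi_n_eq:
  assumes "n > 0"
  shows "Psi_n F p q c n = 1 - real (card {i. i < n \<and> c \<le> dist ((F ^^ i) p) ((F ^^ i) q)}) / real n"
proof -
  let ?A = "{i. i < n \<and> dist ((F ^^ i) p) ((F ^^ i) q) < c}"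
  let ?B = "{i. i < n \<and> c \<le> dist ((F ^^ i) p) ((F ^^ i) q)}"
  have "card ?A + card ?B = card (?A \<union> ?B)" by (subst card_Un_disjoint) auto
  also have "?A \<union> ?B = {..<n}" by auto
  finally have "real (card ?A) = real n - real (card ?B)" by simp
  then show ?thesis using assms by (simp add: Psi_n_def xi_def diff_divide_distrib)
qed

text \<open>One far time in each window of length \<open>P\<close> keeps the upper density of the
  close times at or below 1 - 1/P.\<close>

lemma not_DC2_pair_if_syndetic_far:
  assumes "syndetic_far (\<lambda>i. dist ((F ^^ i) p) ((F ^^ i) q))"
  shows "\<not> DC2_pair F p q"
proof -
  let ?d = "\<lambda>i. dist ((F ^^ i) p) ((F ^^ i) q)"
  obtain c P N where c: "c > 0" "P > (0::nat)" "\<And>t. t \<ge> N \<Longrightarrow> \<exists>i\<in>{t..<t + P}. c \<le> ?d i"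
    using assms unfolding syndetic_far_def by blast
  have far: "real (card {i. i < n \<and> c \<le> ?d i}) \<ge> (real n - real N) / real P - 1" for n
  proof -
    \<comment> \<open>\<open>h k\<close> is a far time in the \<open>k\<close>-th window after
      \<open>N\<close>; the windows are disjoint, so counting the \<open>m\<close> complete ones
      below \<open>n\<close> bounds the number of far times from below.\<close>
    define h where "h k = (SOME i. i \<in> {N + k * P..<N + k * P + P} \<and> c \<le> ?d i)" for k
    have h: "h k \<in> {N + k * P..<N + k * P + P} \<and> c \<le> ?d (h k)" for k
    proof -
      have "\<exists>i. i \<in> {N + k * P..<N + k * P + P} \<and> c \<le> ?d i" using c(3)[of "N + k * P"] by auto
      then show ?thesis unfolding h_def by (rule someI_ex)
    qed
    define m where "m = (n - N) div P"
    have "inj_on h {..<m}"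
    proof (rule linorder_inj_onI)
      fix k k' :: nat assume "k < k'"
      then have "Suc k * P \<le> k' * P" by (intro mult_right_mono) auto
      then show "h k \<noteq> h k'" using h[of k] h[of k'] by auto
    qed auto
    moreover have "h k < n" if "k < m" for k
    proof -
      have "Suc k * P \<le> m * P" using that by (intro mult_right_mono) auto
      also have "\<dots> \<le> n - N" by (simp add: m_def)
      finally show ?thesis using h[of k] \<open>P > 0\<close> by auto
    qed
    ultimately have "card {..<m} \<le> card {i. i < n \<and> c \<le> ?d i}"
      using h by (intro card_inj_on_le[of h]) auto
    moreover have "real m \<ge> (real n - real N) / real P - 1"
    proof -
      have "real n - real N \<le> real (n - N)" by linarith
      also have "real (n - N) = real P * real m + real ((n - N) mod P)"
        unfolding m_def by (metis mult_div_mod_eq of_nat_add of_nat_mult)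
      also have "real ((n - N) mod P) \<le> real P" using \<open>P > 0\<close> by (simp add: less_imp_le)
      finally show ?thesis using \<open>P > 0\<close> by (simp add: field_simps)
    qed
    ultimately show ?thesis by simp
  qed
  have "Psi_upper F p q c \<le> limsup (\<lambda>n. ereal (1 - ((real n - real N) / real P - 1) / real n))"
    unfolding Psi_upper_def
  proof (rule Limsup_mono)
    show "\<forall>\<^sub>F n in sequentially. ereal (Psi_n F p q c n) \<le> ereal (1 - ((real n - real N) / real P - 1) / real n)"
      using eventually_gt_at_top[of 0]
    proof eventually_elim
      case (elim n)
      then show ?case using far[of n] by (simp add: Psi_n_eq divide_right_mono)
    qed
  qed
  also have "\<dots> = ereal (1 - 1 / real P)"
  proof (rule lim_imp_Limsup)
    have "(\<lambda>n. 1 - (1 / real P - (real N / real P + 1) * (1 / real n))) \<longlonglongrightarrow> 1 - (1 / real P - (real N / real P + 1) * 0)"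
      by (intro tendsto_intros lim_1_over_n)
    moreover have "\<forall>\<^sub>F n in sequentially. 1 - (1 / real P - (real N / real P + 1) * (1 / real n))
        = 1 - ((real n - real N) / real P - 1) / real n"
      using eventually_gt_at_top[of 0]
    proof eventually_elim
      case (elim n)
      then show ?case using \<open>P > 0\<close> by (simp add: field_simps)
    qed
    ultimately have "(\<lambda>n. 1 - ((real n - real N) / real P - 1) / real n) \<longlonglongrightarrow> 1 - 1 / real P"
      by (auto intro: Lim_transform_eventually)
    then show "(\<lambda>n. ereal (1 - ((real n - real N) / real P - 1) / real n)) \<longlonglongrightarrow> ereal (1 - 1 / real P)"
      by simp
  qed simp
  also have "\<dots> < 1" using \<open>P > 0\<close> by simp
  finally show ?thesis using c(1) by (auto simp: DC2_pair_def)
qed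

lemma not_DC2_pair_if_rarely_far:
  assumes "rarely_far (\<lambda>i. dist ((F ^^ i) p) ((F ^^ i) q))"
  shows "\<not> DC2_pair F p q"
proof -
  have "(\<lambda>n. ereal (Psi_n F p q c n)) \<longlonglongrightarrow> 1" if "c > 0" for c
  proof -
    have "(\<lambda>n. 1 - real (card {i. i < n \<and> c \<le> dist ((F ^^ i) p) ((F ^^ i) q)}) / real n) \<longlonglongrightarrow> 1 - 0"
      using assms that unfolding rarely_far_def by (intro tendsto_intros) auto
    moreover have "\<forall>\<^sub>F n in sequentially. 1 - real (card {i. i < n \<and> c \<le> dist ((F ^^ i) p) ((F ^^ i) q)}) / real n
        = Psi_n F p q c n"
      using eventually_gt_at_top[of 0] by eventually_elim (simp add: Psi_n_eq)
    ultimately have "(\<lambda>n. Psi_n F p q c n) \<longlonglongrightarrow> 1" by (auto intro: Lim_transform_eventually)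
    then show ?thesis by (simp add: one_ereal_def)
  qed
  then have "Psi_lower F p q c = 1" if "c > 0" for c
    unfolding Psi_lower_def using that by (intro lim_imp_Liminf) auto
  then show ?thesis by (auto simp: DC2_pair_def)
qed

lemma sum_split_lessThan:
  fixes d :: "nat \<Rightarrow> 'a::comm_monoid_add"
  shows "sum d {..<a + b} = sum d {..<a} + (\<Sum>i<b. d (a + i))"
  by (induction b) (auto simp: add.assoc)

text \<open>By Markov's inequality a block of length \<open>2 ^ k\<close> with distance sum at most
  1 has at most 1/c far times. Their density is then at most (1/2)^k / c, and \<open>k\<close> is
  arbitrary.\<close>

lemma rarely_far_if_block_sums:
  assumes "\<And>i. 0 \<le> d i" "\<And>i. d i \<le> 1"
    and blocks: "\<And>k::nat. \<exists>N. \<forall>t\<ge>N. 2 ^ k dvd t - N \<longrightarrow> (\<Sum>i<2 ^ k. d (t + i)) \<le> 1"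
  shows "rarely_far d"
  unfolding rarely_far_def
proof (intro allI impI)
  fix c :: real assume "c > 0"
  let ?C = "\<lambda>n. real (card {i. i < n \<and> c \<le> d i})"
  have sum_bound: "c * ?C n \<le> (\<Sum>i<n. d i)" for n
  proof -
    have "c * ?C n = (\<Sum>i | i < n \<and> c \<le> d i. c)" by simp
    also have "\<dots> \<le> (\<Sum>i | i < n \<and> c \<le> d i. d i)" by (intro sum_mono) auto
    also have "\<dots> \<le> (\<Sum>i<n. d i)" using assms(1) by (intro sum_mono2) auto
    finally show ?thesis .
  qed
  show "(\<lambda>n. ?C n / real n) \<longlonglongrightarrow> 0"
  proof (rule LIMSEQ_I)
    fix r :: real assume "r > 0"
    \<comment> \<open>Half of the allowance \<open>r\<close> pays for the blocks; the other half
      absorbs the initial segment below \<open>N\<close> and the incomplete last block, once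
      \<open>n\<close> is large.\<close>
    obtain k where k: "(1/2) ^ k < c * r / 2"
      using real_arch_pow_inv[of "c * r / 2" "1/2"] \<open>c > 0\<close> \<open>r > 0\<close> by auto
    obtain N where N: "\<And>t. t \<ge> N \<Longrightarrow> 2 ^ k dvd t - N \<Longrightarrow> (\<Sum>i<2 ^ k. d (t + i)) \<le> 1"
      using blocks[of k] by blast
    have blk: "(\<Sum>i<N + m * 2 ^ k. d i) \<le> real N + real m" for m
    proof (induction m)
      case 0
      have "(\<Sum>i<N. d i) \<le> (\<Sum>i<N. 1)" using assms(2) by (intro sum_mono) auto
      then show ?case by simp
    next
      case (Suc m)
      have "(\<Sum>i<N + Suc m * 2 ^ k. d i) = (\<Sum>i<(N + m * 2 ^ k) + 2 ^ k. d i)" by (simp add: algebra_simps)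
      also have "\<dots> = (\<Sum>i<N + m * 2 ^ k. d i) + (\<Sum>i<2 ^ k. d (N + m * 2 ^ k + i))"
        by (simp only: sum_split_lessThan)
      also have "\<dots> \<le> real N + real m + 1" using Suc N[of "N + m * 2 ^ k"] by simp
      finally show ?case by simp
    qed
    obtain n0 where n0: "real n0 > 2 * (real N + 1) / (c * r)" using reals_Archimedean2 by blast
    show "\<exists>no. \<forall>n\<ge>no. norm (?C n / real n - 0) < r"
    proof (intro exI[of _ "Suc n0"] allI impI)
      fix n assume n: "n \<ge> Suc n0"
      define m where "m = n div 2 ^ k + 1"
      have "n \<le> N + m * 2 ^ k"
        using div_mult_mod_eq[of n "2 ^ k"] mod_power2_less[of n k]
        unfolding m_def add_mult_distrib by linarith
      then have "(\<Sum>i<n. d i) \<le> (\<Sum>i<N + m * 2 ^ k. d i)" using assms(1) by (intro sum_mono2) auto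
      then have "c * ?C n \<le> real N + real m" using sum_bound[of n] blk[of m] by linarith
      also have "real m \<le> real n * (1/2) ^ k + 1"
        using of_nat_div_le_of_nat[of n "2 ^ k", where 'a = real] by (simp add: m_def power_divide)
      also have "real n * (1/2) ^ k \<le> real n * (c * r / 2)" using k by (intro mult_left_mono) auto
      finally have 1: "c * ?C n \<le> real N + 1 + real n * (c * r / 2)" by simp
      have "real n > 2 * (real N + 1) / (c * r)" using n n0 by linarith
      then have "real N + 1 < real n * (c * r / 2)" using \<open>c > 0\<close> \<open>r > 0\<close> by (simp add: field_simps)
      with 1 have "c * ?C n < c * (real n * r)" by (simp add: algebra_simps)
      then have "?C n < real n * r" using \<open>c > 0\<close> by simp
      then show "norm (?C n / real n - 0) < r" using n by (simp add: field_simps)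
    qed
  qed
qed

lemma gap_memb:
  fixes k :: nat
  assumes "x \<in> J k" "x \<notin> J (Suc k)" "(base ^^ (2 ^ k)) x \<notin> J (Suc k)"
  obtains z where "x = chart k z" "lo k < z" "z < hi k"
proof -
  obtain z where z: "x = chart k z" "0 \<le> z" "z \<le> 1" using assms(1) by (auto simp: J_def)
  moreover have "z < hi k" using assms(2) z by (force simp: J_Suc)
  moreover have "lo k < z" using assms(3) base_D[of x k] z by (force simp: D_def)
  ultimately show thesis using that by blast
qed

text \<open>Let \<open>k\<close> be the last level visited. All later returns to \<open>J k\<close>
  lie in the open gap, where the return map is affine with slope \<open>- s\<close> and
  \<open>s > 1\<close> in the chart. Successive differences grow like \<open>s ^ j\<close> within a
  bounded interval, so the first one is 0 and the point is fixed by the return map.\<close>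

lemma not_visiting_eventually_periodic:
  assumes x: "x \<in> {0..1}" and nv: "\<forall>t. (base ^^ t) x \<notin> J K"
  obtains N P where "P > 0" "\<And>t. t \<ge> N \<Longrightarrow> (base ^^ (t + P)) x = (base ^^ t) x"
proof -
  have "\<exists>k. (\<exists>t. (base ^^ t) x \<in> J k) \<and> (\<forall>t. (base ^^ t) x \<notin> J (Suc k))"
    using nv
  proof (induction K)
    case 0
    then show ?case using x by (auto simp: J_0 dest: spec[of _ 0])
  qed blast
  then obtain k t0 where t0: "(base ^^ t0) x \<in> J k" and out: "\<And>t. (base ^^ t) x \<notin> J (Suc k)" by blast
  define w where "w j = (base ^^ (t0 + j * 2 ^ k)) x" for j
  have w_Suc: "w (Suc j) = (base ^^ (2 ^ k)) (w j)" for j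
  proof -
    have "t0 + Suc j * 2 ^ k = 2 ^ k + (t0 + j * 2 ^ k)" by simp
    then show ?thesis by (simp only: w_def funpow_add comp_apply)
  qed
  have wJ: "w j \<in> J k" for j
    by (induction j) (simp_all add: w_Suc base_J, simp add: w_def t0)
  have "\<exists>z. w j = chart k z \<and> lo k < z \<and> z < hi k" for j
    using gap_memb[OF wJ[of j]] out w_Suc[of j] unfolding w_def by metis
  then obtain z where z: "\<And>j. w j = chart k (z j)" "\<And>j. lo k < z j" "\<And>j. z j < hi k" by metis
  have z_Suc: "z (Suc j) = hi k - (hi k - lo k * lo (Suc k)) * (z j - lo k) / (hi k - lo k)" for j
  proof -
    have "chart k (z (Suc j)) = chart k (tower_map k (z j))"
      using z[of j] z(1)[of "Suc j"] w_Suc[of j] lo_hi[of k] by (simp add: base_chart)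
    then show ?thesis using z[of j] by (simp add: chart_inj tower_map_gap)
  qed
  define s where "s = (hi k - lo k * lo (Suc k)) / (hi k - lo k)"
  have "lo k * lo (Suc k) < lo k * 1" using lo_hi[of k] lo_hi[of "Suc k"] by (intro mult_strict_left_mono) auto
  then have s: "s > 1" using lo_hi[of k] by (simp add: s_def)
  have z_s: "z (Suc j) = hi k - s * (z j - lo k)" for j by (simp add: z_Suc s_def)
  have step: "\<bar>z (Suc j) - z j\<bar> = s ^ j * \<bar>z 1 - z 0\<bar>" for j
  proof (induction j)
    case (Suc j)
    have "z (Suc (Suc j)) - z (Suc j) = - s * (z (Suc j) - z j)"
      unfolding z_s[of "Suc j"] by (subst (2) z_s[of j]) (simp add: algebra_simps)
    then show ?case using Suc s by (simp add: abs_mult)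
  qed simp
  have "z 1 = z 0"
  proof (rule ccontr)
    assume "z 1 \<noteq> z 0"
    then obtain j where "s ^ j > 1 / \<bar>z 1 - z 0\<bar>" using real_arch_pow[OF s] by blast
    then have "s ^ j * \<bar>z 1 - z 0\<bar> > 1" using \<open>z 1 \<noteq> z 0\<close> by (simp add: field_simps)
    then show False using step[of j] z(2,3)[of j] z(2,3)[of "Suc j"] lo_hi[of k] by linarith
  qed
  then have fixed: "(base ^^ (2 ^ k)) ((base ^^ t0) x) = (base ^^ t0) x"
    using z(1)[of 0] z(1)[of 1] w_Suc[of 0] by (simp add: w_def)
  show thesis
  proof (rule that[of "2 ^ k" t0])
    fix t assume "t \<ge> t0"
    then obtain i where "t = i + t0" by (metis add.commute le_Suc_ex)
    then show "(base ^^ (t + 2 ^ k)) x = (base ^^ t) x"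
      using arg_cong[OF fixed, of "base ^^ i"]
      by (simp add: funpow_add[symmetric, THEN fun_cong, simplified] ac_simps)
  qed simp
qed

lemma periodic_mult:
  assumes "\<And>t. t \<ge> N \<Longrightarrow> g (t + P) = g t" "t \<ge> (N::nat)"
  shows "g (t + j * P) = g t"
proof (induction j)
  case (Suc j)
  have "g (t + Suc j * P) = g ((t + j * P) + P)" by (simp add: algebra_simps)
  then show ?case using Suc assms by simp
qed simp

text \<open>If both orbits visit every \<open>J k\<close>, they either meet in each
  \<open>J k\<close> simultaneously and \<open>sum_dist_tower_le\<close> applies, or are out of
  phase at some level and far apart once per period. An orbit missing some \<open>J k\<close> is
  eventually periodic: its finite tail stays away from the returns of the other orbit to
  \<open>J k\<close>, or both are eventually periodic and so is their distance.\<close>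

lemma base_pair_dichotomy:
  assumes x: "x \<in> {0..1}" "x' \<in> {0..1}"
  shows "syndetic_far (\<lambda>i. \<bar>(base ^^ i) x - (base ^^ i) x'\<bar>) \<or> rarely_far (\<lambda>i. \<bar>(base ^^ i) x - (base ^^ i) x'\<bar>)"
    (is "syndetic_far ?d \<or> rarely_far ?d")
proof -
  have d_bounds: "0 \<le> ?d i" "?d i \<le> 1" for i using base_range[OF x(1), of i] base_range[OF x(2), of i] by auto
  have one_sided: "syndetic_far (\<lambda>i. \<bar>(base ^^ i) x - (base ^^ i) x'\<bar>)"
    if x': "x' \<in> {0..1}" and v: "(base ^^ t0) x \<in> J K" and nv: "\<forall>t. (base ^^ t) x' \<notin> J K" for x x' t0 K
  proof -
    obtain N P where NP: "P > 0" "\<And>t. t \<ge> N \<Longrightarrow> (base ^^ (t + P)) x' = (base ^^ t) x'"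
      using not_visiting_eventually_periodic[OF x' nv] by blast
    define V where "V = (\<lambda>t. (base ^^ t) x') ` {N..<N + P}"
    have V: "(base ^^ t) x' \<in> V" if "t \<ge> N" for t
    proof -
      define i where "i = N + (t - N) mod P"
      have "t = i + ((t - N) div P) * P" using that by (simp add: i_def)
      then have "(base ^^ t) x' = (base ^^ i) x'"
        using periodic_mult[of N "\<lambda>t. (base ^^ t) x'" P i "(t - N) div P"] NP(2) by (simp add: i_def)
      moreover have "i \<in> {N..<N + P}" using NP(1) by (simp add: i_def)
      ultimately show ?thesis by (auto simp: V_def)
    qed
    have "V \<inter> J K = {}" using nv by (auto simp: V_def)
    then obtain c where c: "c > 0" "\<And>y v. y \<in> V \<Longrightarrow> v \<in> J K \<Longrightarrow> c \<le> dist y v"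
      using separate_compact_closed[OF finite_imp_compact compact_imp_closed[OF compact_J], of V K]
      by (auto simp: V_def)
    show ?thesis unfolding syndetic_far_def
    proof (intro exI conjI allI impI)
      fix t assume t: "t \<ge> N + t0"
      obtain i where i: "i \<in> {t..<t + 2 ^ K}" "2 ^ K dvd i - t0"
        using residue_in_window[of t0 t "2 ^ K"] t by auto
      have "(base ^^ i) x \<in> J K"
        using funpow_split[of t0 i base x] base_J_mult[OF v i(2)] i(1) t by simp
      with i(1) show "\<exists>i\<in>{t..<t + 2 ^ K}. c \<le> \<bar>(base ^^ i) x - (base ^^ i) x'\<bar>"
        using c(2)[OF V[of i], of "(base ^^ i) x"] t by (intro bexI[of _ i]) (simp_all add: dist_real_def abs_minus_commute)
    qed (use c(1) in auto)
  qed
  show ?thesis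
  proof (cases "\<forall>k. (\<exists>t. (base ^^ t) x \<in> J k) \<and> (\<exists>t. (base ^^ t) x' \<in> J k)")
    case True
    show ?thesis
    proof (cases "\<forall>k. \<exists>t. (base ^^ t) x \<in> J k \<and> (base ^^ t) x' \<in> J k")
      case True
      have "rarely_far ?d"
      proof (rule rarely_far_if_block_sums[OF d_bounds])
        fix k
        obtain N where N: "(base ^^ N) x \<in> J k" "(base ^^ N) x' \<in> J k" using True by blast
        show "\<exists>N. \<forall>t\<ge>N. 2 ^ k dvd t - N \<longrightarrow> (\<Sum>i<2 ^ k. ?d (t + i)) \<le> 1"
        proof (intro exI[of _ N] allI impI)
          fix t assume t: "N \<le> t" "2 ^ k dvd t - N"
          have *: "(base ^^ t) y \<in> J k" if "(base ^^ N) y \<in> J k" for y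
          proof -
            have "(base ^^ t) y = (base ^^ (t - N)) ((base ^^ N) y)" by (rule funpow_split[OF t(1)])
            then show ?thesis using base_J_mult[OF that t(2)] by simp
          qed
          have "(\<Sum>i<2 ^ k. ?d (t + i)) = (\<Sum>i<2 ^ k. \<bar>(base ^^ i) ((base ^^ t) x) - (base ^^ i) ((base ^^ t) x')\<bar>)"
            by (simp only: funpow_add comp_apply add.commute[of t])
          then show "(\<Sum>i<2 ^ k. ?d (t + i)) \<le> 1" using sum_dist_tower_le[OF *[OF N(1)] *[OF N(2)]] by simp
        qed
      qed
      then show ?thesis ..
    next
      case False
      then obtain k where never: "\<And>t. \<not> ((base ^^ t) x \<in> J k \<and> (base ^^ t) x' \<in> J k)" by blast
      obtain t0 t1 where t: "(base ^^ t0) x \<in> J k" "(base ^^ t1) x' \<in> J k"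
        using \<open>\<forall>k. _ \<and> _\<close> by blast
      \<comment> \<open>The other floors of the tower over \<open>J k\<close>. Being compact and
        disjoint from \<open>J k\<close>, they have positive distance from it, and \<open>x'\<close>
        is in one of them whenever \<open>x\<close> is in \<open>J k\<close> at a late time.\<close>
      define V where "V = (\<Union>i\<in>{0<..<2 ^ k}. (base ^^ i) ` J k)"
      have "V \<inter> J k = {}"
        using base_return nat_dvd_not_less by (fastforce simp: V_def)
      moreover have "compact V" unfolding V_def by (intro compact_UN) (auto intro: compact_base_J)
      ultimately obtain c where c: "c > 0" "\<And>y v. y \<in> V \<Longrightarrow> v \<in> J k \<Longrightarrow> c \<le> dist y v"
        using separate_compact_closed[of V "J k"] compact_imp_closed[OF compact_J] by blast
      have "syndetic_far ?d" unfolding syndetic_far_def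
      proof (intro exI conjI allI impI)
        fix t assume tt: "t \<ge> t0 + t1"
        obtain i where i: "i \<in> {t..<t + 2 ^ k}" "2 ^ k dvd i - t0"
          using residue_in_window[of t0 t "2 ^ k"] tt by auto
        have xi: "(base ^^ i) x \<in> J k"
          using base_J_mult[OF t(1) i(2)] funpow_split[of t0 i base x] i(1) tt by simp
        define m where "m = (i - t1) mod 2 ^ k"
        have "(base ^^ i) x' = (base ^^ m) ((base ^^ ((i - t1) div 2 ^ k * 2 ^ k)) ((base ^^ t1) x'))"
        proof -
          have "i - t1 = m + (i - t1) div 2 ^ k * 2 ^ k" by (simp only: m_def mod_div_mult_eq)
          then have "(base ^^ (i - t1)) y = (base ^^ m) ((base ^^ ((i - t1) div 2 ^ k * 2 ^ k)) y)" for y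
            by (metis funpow_add comp_apply)
          then show ?thesis using funpow_split[of t1 i base x'] i(1) tt by simp
        qed
        moreover have "(base ^^ ((i - t1) div 2 ^ k * 2 ^ k)) ((base ^^ t1) x') \<in> J k"
          by (rule base_J_mult[OF t(2)]) simp
        moreover from calculation have "m \<noteq> 0" using never[of i] xi by (metis funpow_0)
        moreover have "m < 2 ^ k" by (simp add: m_def)
        ultimately have "(base ^^ i) x' \<in> V" by (auto simp: V_def)
        from c(2)[OF this xi] show "\<exists>i\<in>{t..<t + 2 ^ k}. c \<le> ?d i"
          using i(1) by (intro bexI[of _ i]) (simp_all add: dist_real_def abs_minus_commute)
      qed (use c(1) in auto)
      then show ?thesis ..
    qed
  next
    case False
    then obtain k where k: "(\<forall>t. (base ^^ t) x \<notin> J k) \<or> (\<forall>t. (base ^^ t) x' \<notin> J k)" by blast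
    show ?thesis
    proof (cases "(\<forall>t. (base ^^ t) x \<notin> J k) \<and> (\<forall>t. (base ^^ t) x' \<notin> J k)")
      case False
      then consider t where "(base ^^ t) x \<in> J k" "\<forall>t. (base ^^ t) x' \<notin> J k"
        | t where "(base ^^ t) x' \<in> J k" "\<forall>t. (base ^^ t) x \<notin> J k" using k by blast
      then show ?thesis
      proof cases
        case 1
        then show ?thesis using one_sided[OF x(2)] by blast
      next
        case 2
        then show ?thesis using one_sided[OF x(1), of t x' k] by (simp add: abs_minus_commute)
      qed
    next
      case True
      obtain N P where NP: "P > 0" "\<And>t. t \<ge> N \<Longrightarrow> (base ^^ (t + P)) x = (base ^^ t) x"
        using not_visiting_eventually_periodic[OF x(1) conjunct1[OF True]] by metis
      obtain N' P' where NP': "P' > 0" "\<And>t. t \<ge> N' \<Longrightarrow> (base ^^ (t + P')) x' = (base ^^ t) x'"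
        using not_visiting_eventually_periodic[OF x(2) conjunct2[OF True]] by metis
      have per: "?d (t + j * (P * P')) = ?d t" if "t \<ge> N + N'" for t j
        using periodic_mult[of N "\<lambda>t. (base ^^ t) x" P t "j * P'"] NP(2)
          periodic_mult[of N' "\<lambda>t. (base ^^ t) x'" P' t "j * P"] NP'(2) that
        by (simp add: ac_simps)
      show ?thesis
      proof (cases "\<exists>t\<ge>N + N'. ?d t > 0")
        case True
        then obtain t0 where t0: "t0 \<ge> N + N'" "?d t0 > 0" by blast
        have "syndetic_far ?d" unfolding syndetic_far_def
        proof (intro exI conjI allI impI)
          fix t assume t: "t \<ge> t0"
          obtain i where i: "i \<in> {t..<t + P * P'}" "P * P' dvd i - t0"
            using residue_in_window[of t0 t "P * P'"] t NP(1) NP'(1) by auto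
          then obtain j where "i - t0 = P * P' * j" by blast
          moreover have "t0 \<le> i" using i(1) t by simp
          ultimately have "i = t0 + j * (P * P')" by (metis le_add_diff_inverse mult.commute)
          then show "\<exists>i\<in>{t..<t + P * P'}. ?d t0 \<le> ?d i"
            using per[OF t0(1), of j] i(1) by (intro bexI[of _ i]) simp_all
        qed (use t0 NP NP' in auto)
        then show ?thesis ..
      next
        case False
        have "rarely_far ?d"
        proof (rule rarely_far_if_block_sums[OF d_bounds])
          fix k
          have "?d (t + i) = 0" if "t \<ge> N + N'" for t i
          proof -
            have "\<not> ?d (t + i) > 0" using False that by auto
            then show ?thesis using d_bounds(1)[of "t + i"] by linarith
          qed
          then show "\<exists>N. \<forall>t\<ge>N. 2 ^ k dvd t - N \<longrightarrow> (\<Sum>i<2 ^ k. ?d (t + i)) \<le> 1"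
            by (intro exI[of _ "N + N'"]) simp
        qed
        then show ?thesis ..
      qed
    qed
  qed
qed

section \<open>The skew product\<close>

text \<open>The length of \<open>D k\<close>, and also of the gap beside it, since
  \<open>hi k\<close> is twice \<open>lo k\<close>.\<close>

lemma chart_factor_lo: "(1/2 + (1/2)^k / 2) * lo k = (1/2)^k / 8"
proof -
  have "(1/2 + (1/2)^k / 2) * hi k = (1/2)^k / 4"
  proof -
    have "c * r = c - c * (1 - r)" for c r :: real by (simp add: algebra_simps)
    then have "(1/2 + (1/2)^k / 2) * hi k = (1/2 + (1/2)^k / 2) - (1/2 + (1/2) ^ Suc k / 2)"
      by (metis one_minus_hi)
    then show ?thesis by simp
  qed
  then have "(1/2 + (1/2)^k / 2) * hi k / 2 = (1/2)^k / 4 / 2" by (rule arg_cong)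
  then show ?thesis unfolding lo_def times_divide_eq_right by simp
qed

lemma hi_eq_lo: "hi k = 2 * lo k" by (simp add: lo_def)

text \<open>The union of all \<open>D k\<close> and of the intersection of all \<open>J k\<close>,
  written as an intersection of finite unions so that closedness is immediate.\<close>

definition strips :: "real set" where "strips = (\<Inter>k. J k \<union> (\<Union>i<k. D i))"

text \<open>The margins of one eighth keep this set away from the strips, yet a point whose returns
  stay in the gap a few times must lie in it (\<open>long_gap_stay\<close>).\<close>

definition mid_gaps :: "real set" where
  "mid_gaps = {chart k z | k z. lo k + lo k / 8 \<le> z \<and> z \<le> hi k - lo k / 8}"

lemma closed_strips: "closed strips"
  unfolding strips_def
  by (intro closed_INT ballI closed_Un closed_UN finite_lessThan compact_imp_closed compact_J compact_D)

lemma D_subset_strips: "D k \<subseteq> strips"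
proof -
  have "D k \<subseteq> J j \<union> (\<Union>i<j. D i)" for j
    using D_subset_J[of k] J_mono[of j k] by (cases "k < j") auto
  then show ?thesis by (auto simp: strips_def)
qed

lemma mid_gaps_strips_disjoint: "mid_gaps \<inter> strips = {}"
proof -
  have "chart k z \<notin> strips" if z: "lo k + lo k / 8 \<le> z" "z \<le> hi k - lo k / 8" for k z
  proof
    assume "chart k z \<in> strips"
    then have "chart k z \<in> J (Suc k) \<union> (\<Union>i<Suc k. D i)" unfolding strips_def by blast
    moreover have "chart k z \<notin> J (Suc k)" using z lo_hi[of k] by (auto simp: J_Suc chart_inj)
    moreover have "chart k z \<notin> D k" using z lo_hi[of k] by (auto simp: D_def chart_inj)
    moreover have "chart k z \<in> J k" using z lo_hi[of k] by (auto simp: J_def)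
    then have "chart k z \<notin> D i" if "i < k" for i
      using D_J_disjoint[of i] J_mono[of "Suc i" k] that by auto
    ultimately show False by (auto simp: less_Suc_eq)
  qed
  then show ?thesis by (auto simp: mid_gaps_def)
qed

text \<open>The sign of the fibre maps alternates with the level of the strip. The factor
  \<open>1 - infdist x strips\<close> and the vanishing of \<open>squeeze\<close> on \<open>mid_gaps\<close> destroy the chaos over the
  periodic orbits of the base, which lie in the gaps, without affecting the strips.\<close>
definition theta :: "real \<Rightarrow> real" where
  "theta x = max (-1) (min 1 (7/3 - 4 * x)) * (1 - infdist x strips)"

definition squeeze :: "real \<Rightarrow> real" where "squeeze x = min 1 (128 * infdist x mid_gaps)"

lemma continuous_on_theta: "continuous_on A theta"
  unfolding theta_def by (intro continuous_intros)

lemma continuous_on_squeeze: "continuous_on A squeeze"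
  unfolding squeeze_def by (intro continuous_intros)

lemma zero_in_strips: "0 \<in> strips"
  using D_subset_strips[of 0] lo_hi[of 0] by (auto simp: D_def chart_0)

lemma theta_bound:
  assumes "x \<in> {0..1}" shows "\<bar>theta x\<bar> \<le> 1 - infdist x strips" "\<bar>theta x\<bar> \<le> 1"
proof -
  have "infdist x strips \<le> dist x 0" by (rule infdist_le[OF zero_in_strips])
  then have 1: "0 \<le> 1 - infdist x strips" using assms by (simp add: dist_real_def)
  have "\<bar>theta x\<bar> = \<bar>max (-1) (min 1 (7/3 - 4 * x))\<bar> * (1 - infdist x strips)"
    using 1 by (simp add: theta_def abs_mult)
  also have "\<dots> \<le> 1 * (1 - infdist x strips)" using 1 by (intro mult_right_mono) auto
  finally show "\<bar>theta x\<bar> \<le> 1 - infdist x strips" by simp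
  then show "\<bar>theta x\<bar> \<le> 1" using infdist_nonneg[of x strips] by linarith
qed

lemma theta_D: "x \<in> D k \<Longrightarrow> theta x = (-1) ^ k"
proof -
  assume x: "x \<in> D k"
  then obtain z where z: "x = chart k z" "0 \<le> z" "z \<le> lo k" by (auto simp: D_def)
  have "(1/2 + (1/2)^k / 2) * z \<le> (1/2 + (1/2)^k / 2) * lo k" using z by (intro mult_left_mono) auto
  then have le: "(1/2 + (1/2)^k / 2) * z \<le> (1/2)^k / 8" by (simp add: chart_factor_lo)
  have pos: "(0::real) < (1/2)^k" by simp
  have "infdist x strips = 0" using subsetD[OF D_subset_strips x] by simp
  \<comment> \<open>The affine function 7/3 - 4 x takes the value 1 at 1/3 and -1 at 5/6, the ends
    of the wandering interval; even strips lie to the left of 1/3, odd ones to the right of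
    5/6.\<close>
  moreover have "max (-1) (min 1 (7/3 - 4 * x)) = (-1) ^ k"
  proof (cases "even k")
    case True
    then have "x = 1/3 - (1/2)^k / 3 + (1/2 + (1/2)^k / 2) * z" using z by (simp add: chart_def)
    then have "x \<le> 1/3" using le pos by linarith
    then show ?thesis using True by simp
  next
    case False
    then have "x = 5/6 + (1/2)^k / 3 - (1/2 + (1/2)^k / 2) * z" using z by (simp add: chart_def)
    then have "x \<ge> 5/6" using le pos by linarith
    then show ?thesis using False by simp
  qed
  ultimately show ?thesis by (simp add: theta_def)
qed

lemma theta_mid_gaps: "x \<in> mid_gaps \<Longrightarrow> x \<in> {0..1} \<Longrightarrow> \<bar>theta x\<bar> < 1"
proof -
  assume x: "x \<in> mid_gaps" "x \<in> {0..1}"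
  have "x \<notin> strips" using x mid_gaps_strips_disjoint by blast
  then have "infdist x strips > 0"
    using closed_strips zero_in_strips infdist_pos_not_in_closed by blast
  then show ?thesis using theta_bound(1)[OF x(2)] by linarith
qed

lemma squeeze_mid_gaps: "x \<in> mid_gaps \<Longrightarrow> squeeze x = 0"
  by (simp add: squeeze_def)

lemma squeeze_bounds: "0 \<le> squeeze x" "squeeze x \<le> 1"
  by (auto simp: squeeze_def infdist_nonneg)

text \<open>The distance from \<open>D k\<close> to \<open>mid_gaps\<close> is at least the margin
  of the gap at level \<open>k\<close>, an eighth of (1/2)^k / 8. The weaker bound by powers of 1/3
  is stated because the fibre maps expand by 3.\<close>

lemma squeeze_D:
  assumes x: "x \<in> D k" shows "(1/3) ^ (k - 1) \<le> squeeze x"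
proof -
  have far: "(1/2)^k / 64 \<le> dist x y" if yM: "y \<in> mid_gaps" for y
  proof -
    obtain j z' where y: "y = chart j z'" "lo j + lo j / 8 \<le> z'" "z' \<le> hi j - lo j / 8"
      using yM unfolding mid_gaps_def by blast
    have est: "(1/2)^i / 64 \<le> \<bar>chart i u - chart i v\<bar>" if "lo i / 8 \<le> \<bar>u - v\<bar>" for i u v
    proof -
      have "(1/2)^i / 64 = (1/2 + (1/2)^i / 2) * (lo i / 8)" using chart_factor_lo[of i] by simp
      also have "\<dots> \<le> (1/2 + (1/2)^i / 2) * \<bar>u - v\<bar>" using that by (intro mult_left_mono) auto
      finally show ?thesis by (simp add: chart_dist)
    qed
    obtain z where z: "x = chart k z" "0 \<le> z" "z \<le> lo k" using x by (auto simp: D_def)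
    consider "j = k" | "k < j" | "j < k" by linarith
    then show ?thesis
    proof cases
      case 1
      then show ?thesis using est[of k z z'] y z by (simp add: dist_real_def)
    next
      case 2
      have "y \<in> J j" using y lo_hi[of j] by (auto simp: J_def)
      then have "y \<in> J (Suc k)" using J_mono[of "Suc k" j] 2 by auto
      then obtain u where "y = chart k u" "hi k \<le> u" by (auto simp: J_Suc)
      then show ?thesis using est[of k z u] z lo_hi[of k] by (simp add: dist_real_def hi_eq_lo)
    next
      case 3
      have "x \<in> J (Suc j)" using D_subset_J[of k] J_mono[of "Suc j" k] 3 x by auto
      then obtain u where u: "x = chart j u" "hi j \<le> u" by (auto simp: J_Suc)
      have "(1/2)^k / 64 \<le> (1/2)^j / (64::real)" using 3 by (simp add: power_decreasing)
      also have "\<dots> \<le> dist x y"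
      proof -
        have "lo j / 8 \<le> \<bar>u - z'\<bar>" using u y by linarith
        from est[OF this] show ?thesis using u y by (simp add: dist_real_def)
      qed
      finally show ?thesis .
    qed
  qed
  have "mid_gaps \<noteq> {}" using lo_hi[of 0] by (auto simp: mid_gaps_def hi_eq_lo intro!: exI[of _ 0] exI[of _ "lo 0 + lo 0 / 2"])
  then have "(1/2)^k / 64 \<le> infdist x mid_gaps"
    using cINF_greatest[of mid_gaps "(1/2)^k / 64" "dist x"] far by (simp add: infdist_notempty)
  \<comment> \<open>The constant 128 serves to make \<open>squeeze\<close> equal to 1 on
    \<open>D 0\<close> and \<open>D 1\<close>, so that contraction begins only at level 2.\<close>
  then have "2 * (1/2)^k \<le> 128 * infdist x mid_gaps" by simp
  moreover have "(1/3) ^ (k - 1) \<le> 2 * (1/2 :: real)^k"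
  proof (cases k)
    case (Suc j)
    have "(1/3 :: real) ^ j \<le> (1/2) ^ j" by (intro power_mono) auto
    then show ?thesis using Suc by simp
  qed simp
  moreover have "(1/3 :: real) ^ (k - 1) \<le> 1" by (simp add: power_le_one)
  ultimately show ?thesis by (simp add: squeeze_def)
qed

text \<open>In the gap the return map is affine with slope \<open>- s\<close>, where
  \<open>s\<close> is between 15/8 and 2. A point that it keeps in the gap lies within 8/15 of the
  gap's length from the left end. Applied to the next return as well, this keeps the point itself
  more than 7/30 away from that end, and 7/30 exceeds the margin 1/8.\<close>

lemma long_gap_stay:
  assumes "x \<in> J k" and stay: "\<And>i. i \<le> 3 \<Longrightarrow> (base ^^ (i * 2 ^ k)) x \<notin> J (Suc k)"
  shows "x \<in> mid_gaps"
proof -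
  define w where "w i = (base ^^ (i * 2 ^ k)) x" for i
  have w_Suc: "w (Suc i) = (base ^^ (2 ^ k)) (w i)" for i
    by (simp add: w_def funpow_add)
  have wJ: "w i \<in> J k" for i using base_J_mult[OF assms(1)] by (simp add: w_def)
  \<comment> \<open>That \<open>w i\<close> lies in the gap and not in \<open>D k\<close> is seen
    only from the following return, so three positions need four times.\<close>
  have "\<exists>z. w i = chart k z \<and> lo k < z \<and> z < hi k" if "i \<le> 2" for i
    using gap_memb[OF wJ[of i]] stay[of i] stay[of "Suc i"] w_Suc[of i] that unfolding w_def by fastforce
  then obtain z0 z1 z2 where z:
    "w 0 = chart k z0" "lo k < z0" "z0 < hi k"
    "w 1 = chart k z1" "lo k < z1" "z1 < hi k"
    "w 2 = chart k z2" "lo k < z2" "z2 < hi k"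
    by (metis le_refl one_le_numeral zero_le)
  define s where "s = 2 - lo (Suc k)"
  have s: "s \<ge> 15/8" "s \<le> 2" "s > 0" using lo_hi[of "Suc k"] by (auto simp: s_def)
  have step: "v = hi k - s * (u - lo k)"
    if "chart k v = (base ^^ (2 ^ k)) (chart k u)" "lo k < u" "u < hi k" for u v
  proof -
    have "chart k v = chart k (tower_map k u)" using that lo_hi[of k] by (simp add: base_chart)
    then have "v = hi k - (hi k - lo k * lo (Suc k)) * (u - lo k) / (hi k - lo k)"
      using that by (simp add: chart_inj tower_map_gap)
    also have "hi k - lo k * lo (Suc k) = lo k * s" by (simp add: s_def hi_eq_lo algebra_simps)
    finally show ?thesis using lo_hi[of k] by (simp add: hi_eq_lo)
  qed
  have z1: "z1 = hi k - s * (z0 - lo k)" using step[of z1 z0] z w_Suc[of 0] by simp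
  have z2: "z2 = hi k - s * (z1 - lo k)" using step[of z2 z1] z w_Suc[of 1] by (simp add: numeral_2_eq_2)
  have below: "u - lo k < 8/15 * lo k" if "s * (u - lo k) < lo k" "lo k < u" for u
  proof -
    have "15/8 * (u - lo k) \<le> s * (u - lo k)" using s that by (intro mult_right_mono) auto
    then have "15/8 * (u - lo k) < lo k" using that(1) by (rule le_less_trans)
    then show ?thesis by simp
  qed
  have b1: "z1 - lo k < 8/15 * lo k" using below[of z1] z z2 by (simp add: hi_eq_lo)
  have b0: "z0 - lo k < 8/15 * lo k" using below[of z0] z z1 by (simp add: hi_eq_lo)
  have "s * (z0 - lo k) > 7/15 * lo k" using z1 b1 by (simp add: hi_eq_lo)
  moreover have "s * (z0 - lo k) \<le> 2 * (z0 - lo k)" using s z by (intro mult_right_mono) auto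
  ultimately have "7/15 * lo k < 2 * (z0 - lo k)" by (rule less_le_trans)
  then have "z0 - lo k > 7/30 * lo k" by simp
  then have "lo k + lo k / 8 \<le> z0" "z0 \<le> hi k - lo k / 8"
    using b0 lo_hi[of k] by (simp_all add: hi_eq_lo)
  moreover have "x = chart k z0" using z by (simp add: w_def)
  ultimately show ?thesis by (auto simp: mid_gaps_def)
qed

text \<open>The centred fibre coordinate ranges over \<open>{-1..1}\<close>. Points in the open middle half are
  attracted to \<open>0\<close>, which they reach in finite time; the dynamics on the two outer quarters is
  chaotic and is contracted towards \<open>1/2\<close> and \<open>-1/2\<close>, respectively, by the factor \<open>s\<close>.\<close>
definition ear :: "real \<Rightarrow> real" where
  "ear w = max 0 (min 1 (3/2 * (1 - \<bar>4 * w - 3\<bar>)))"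

definition fibre :: "real \<Rightarrow> real \<Rightarrow> real" where
  "fibre s w = max 0 (min (2 * w - 1/2) (1/2)) - max 0 (min (- 2 * w - 1/2) (1/2)) + s / 2 * (ear w - ear (- w))"

definition skew :: "real \<Rightarrow> real \<Rightarrow> real" where
  "skew x w = theta x * fibre (squeeze x) w"

definition skew_map :: "real \<times> real \<Rightarrow> real \<times> real" where
  "skew_map p = (base (fst p), (1 + skew (fst p) (2 * snd p - 1)) / 2)"

lemma ear_range: "0 \<le> ear w" "ear w \<le> 1" by (auto simp: ear_def)

lemma fibre_odd: "fibre s (- w) = - fibre s w"
  by (simp add: fibre_def algebra_simps)

lemma fibre_nonneg_arg:
  "0 \<le> w \<Longrightarrow> fibre s w = max 0 (min (2 * w - 1/2) (1/2)) + s / 2 * ear w"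
proof -
  assume w: "0 \<le> w"
  then have "ear (- w) = 0" "max 0 (min (- 2 * w - 1/2) (1/2)) = 0" by (auto simp: ear_def)
  then show ?thesis by (simp add: fibre_def)
qed

lemma abs_fibre: "0 \<le> s \<Longrightarrow> \<bar>fibre s w\<bar> = fibre s \<bar>w\<bar>"
proof -
  assume s: "0 \<le> s"
  have nonneg: "0 \<le> fibre s u" if "0 \<le> u" for u
    using s ear_range[of u] that by (simp add: fibre_nonneg_arg)
  show ?thesis
  proof (cases "w \<ge> 0")
    case False
    then show ?thesis using nonneg[of "- w"] fibre_odd[of s w] by simp
  qed (simp add: nonneg)
qed

lemma fibre_small: "\<bar>w\<bar> \<le> 1/2 \<Longrightarrow> 0 \<le> s \<Longrightarrow> \<bar>fibre s w\<bar> = max 0 (2 * \<bar>w\<bar> - 1/2)"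
  by (subst abs_fibre, simp, subst fibre_nonneg_arg) (auto simp: ear_def)

lemma fibre_large: "1/2 \<le> w \<Longrightarrow> fibre s w = 1/2 + s / 2 * ear w"
  by (subst fibre_nonneg_arg) auto

lemma fibre_range: "0 \<le> s \<Longrightarrow> s \<le> 1 \<Longrightarrow> \<bar>fibre s w\<bar> \<le> 1/2 + s / 2"
proof -
  assume s: "0 \<le> s" "s \<le> 1"
  have "s * ear \<bar>w\<bar> \<le> s * 1" using s ear_range by (intro mult_left_mono) auto
  then show ?thesis using s ear_range[of "\<bar>w\<bar>"] by (simp add: abs_fibre fibre_nonneg_arg)
qed

lemma skew_range: "x \<in> {0..1} \<Longrightarrow> \<bar>skew x w\<bar> \<le> 1"
proof -
  assume x: "x \<in> {0..1}"
  have "\<bar>fibre (squeeze x) w\<bar> \<le> 1" using fibre_range[of "squeeze x" w] squeeze_bounds[of x] by simp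
  then have "\<bar>theta x\<bar> * \<bar>fibre (squeeze x) w\<bar> \<le> 1 * 1"
    using theta_bound(2)[OF x] by (intro mult_mono) auto
  then show ?thesis by (simp add: skew_def abs_mult)
qed

lemma skew_map_in_unit_square: "p \<in> unit_square \<Longrightarrow> skew_map p \<in> unit_square"
  using skew_range[of "fst p" "2 * snd p - 1"] base_range[of "fst p" 1]
  by (auto simp: skew_map_def unit_square_def)

lemma continuous_on_skew_map: "continuous_on unit_square skew_map"
proof -
  have "continuous_on unit_square (\<lambda>p. base (fst p))"
    by (intro continuous_on_compose2[OF continuous_on_tower_map[of 0]] continuous_intros)
      (auto simp: unit_square_def)
  moreover have "continuous_on unit_square (\<lambda>p. theta (fst p))" "continuous_on unit_square (\<lambda>p. squeeze (fst p))"
    by (auto intro!: continuous_on_compose2[OF continuous_on_theta[of UNIV]]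
        continuous_on_compose2[OF continuous_on_squeeze[of UNIV]] continuous_intros)
  ultimately show ?thesis
    unfolding skew_map_def[abs_def] skew_def fibre_def ear_def by (intro continuous_intros) auto
qed

text \<open>The fibre map is affine in its squeezing parameter, with bounded coefficients; as the
  bound is free of \<open>w\<close>, it yields uniform convergence of the fibre maps.\<close>

lemma skew_diff:
  assumes "x \<in> {0..1}" "x' \<in> {0..1}"
  shows "\<bar>skew x w - skew x' w\<bar> \<le> \<bar>theta x - theta x'\<bar> + \<bar>squeeze x - squeeze x'\<bar>"
proof -
  have "skew x w - skew x' w = (theta x - theta x') * fibre (squeeze x) w
      + theta x' * ((squeeze x - squeeze x') * ((ear w - ear (- w)) / 2))"
    by (simp add: skew_def fibre_def algebra_simps diff_divide_distrib)
  also have "\<bar>\<dots>\<bar> \<le> \<bar>theta x - theta x'\<bar> * \<bar>fibre (squeeze x) w\<bar>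
      + \<bar>theta x'\<bar> * (\<bar>squeeze x - squeeze x'\<bar> * \<bar>(ear w - ear (- w)) / 2\<bar>)"
    by (metis abs_mult abs_triangle_ineq)
  also have "\<dots> \<le> \<bar>theta x - theta x'\<bar> * 1 + 1 * (\<bar>squeeze x - squeeze x'\<bar> * 1)"
  proof (intro add_mono mult_mono)
    show "\<bar>fibre (squeeze x) w\<bar> \<le> 1" using fibre_range[of "squeeze x" w] squeeze_bounds[of x] by simp
    show "\<bar>theta x'\<bar> \<le> 1" by (rule theta_bound(2)[OF assms(2)])
    show "\<bar>(ear w - ear (- w)) / 2\<bar> \<le> 1" using ear_range[of w] ear_range[of "-w"] by simp
  qed auto
  finally show ?thesis by simp
qed

lemma triangular_map_skew_map: "triangular_map skew_map"
  unfolding triangular_map_def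
proof (intro conjI exI ballI)
  let ?g = "\<lambda>x y. (1 + skew x (2 * y - 1)) / 2"
  show "continuous_on unit_square skew_map" by (rule continuous_on_skew_map)
  show "skew_map \<in> unit_square \<rightarrow> unit_square" using skew_map_in_unit_square by auto
  show "continuous_on {0..1} base" by (rule continuous_on_tower_map)
  show "base \<in> {0..1} \<rightarrow> {0..1}" using base_range[of _ 1] by auto
  show "skew_map (x, y) = (base x, ?g x y)" for x y by (simp add: skew_map_def)
  fix x :: real assume x: "x \<in> {0..1}"
  show "continuous_on {0..1} (?g x)"
    unfolding skew_def fibre_def ear_def by (intro continuous_intros) auto
  show "?g x \<in> {0..1} \<rightarrow> {0..1}" 
  proof
    fix y
    show "?g x y \<in> {0..1}" using skew_range[OF x, of "2 * y - 1"] by (auto simp: abs_le_iff)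
  qed
  show "uniform_limit {0..1} ?g (?g x) (at x within {0..1})"
  proof (rule uniform_limitI)
    fix e :: real assume "e > 0"
    have "((\<lambda>x'. \<bar>theta x' - theta x\<bar> + \<bar>squeeze x' - squeeze x\<bar>) \<longlongrightarrow> \<bar>theta x - theta x\<bar> + \<bar>squeeze x - squeeze x\<bar>) (at x within {0..1})"
      using continuous_on_theta[of "{0..1}"] continuous_on_squeeze[of "{0..1}"] x
      by (intro tendsto_intros) (auto simp: continuous_on_def)
    then have "\<forall>\<^sub>F x' in at x within {0..1}. \<bar>theta x' - theta x\<bar> + \<bar>squeeze x' - squeeze x\<bar> < e"
      using \<open>e > 0\<close> by (intro order_tendstoD(2)) auto
    moreover have "\<forall>\<^sub>F x' in at x within {0..1}. x' \<in> {0..1}" by (simp add: eventually_at_filter)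
    ultimately show "\<forall>\<^sub>F x' in at x within {0..1}. \<forall>y\<in>{0..1}. dist (?g x' y) (?g x y) < e"
    proof eventually_elim
      case (elim x')
      have "dist (?g x' y) (?g x y) < e" for y
      proof -
        have "dist (?g x' y) (?g x y) = \<bar>skew x' (2 * y - 1) - skew x (2 * y - 1)\<bar> / 2"
          by (simp add: dist_real_def diff_divide_distrib[symmetric])
        also have "\<dots> \<le> \<bar>skew x' (2 * y - 1) - skew x (2 * y - 1)\<bar>" by simp
        also have "\<dots> < e" using skew_diff[OF elim(2) x, of "2 * y - 1"] elim(1) by linarith
        finally show ?thesis .
      qed
      then show ?case by blast
    qed
  qed
qed

section \<open>Absence of DC2-points\<close>

definition coord :: "real \<times> real \<Rightarrow> real" where "coord p = 2 * snd p - 1"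

lemma fst_skew_map: "fst (skew_map p) = base (fst p)" and coord_skew_map: "coord (skew_map p) = skew (fst p) (coord p)"
  by (simp_all add: skew_map_def coord_def field_simps)

lemma fst_skew_map_funpow: "fst ((skew_map ^^ i) p) = (base ^^ i) (fst p)"
  by (induction i) (simp_all add: fst_skew_map)

lemma skew_map_funpow_in_unit_square: "p \<in> unit_square \<Longrightarrow> (skew_map ^^ i) p \<in> unit_square"
  by (induction i) (auto intro: skew_map_in_unit_square)

lemma unit_square_fst: "p \<in> unit_square \<Longrightarrow> fst p \<in> {0..1}"
  by (auto simp: unit_square_def)

lemma coord_skew_map_small:
  assumes "p \<in> unit_square" "\<bar>coord p\<bar> \<le> 1/2"
  shows "\<bar>coord (skew_map p)\<bar> \<le> max 0 (2 * \<bar>coord p\<bar> - 1/2)"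
proof -
  have "\<bar>coord (skew_map p)\<bar> = \<bar>theta (fst p)\<bar> * max 0 (2 * \<bar>coord p\<bar> - 1/2)"
    using fibre_small[OF assms(2) squeeze_bounds(1)] by (simp add: coord_skew_map skew_def abs_mult)
  also have "\<dots> \<le> 1 * max 0 (2 * \<bar>coord p\<bar> - 1/2)"
    using theta_bound(2)[OF unit_square_fst[OF assms(1)]] by (intro mult_right_mono) auto
  finally show ?thesis by simp
qed

text \<open>The defect \<open>1/2 - \<bar>coord p\<bar>\<close> at least doubles in each step until
  the coordinate is 0.\<close>

lemma coord_funpow_small:
  assumes "p \<in> unit_square" "\<bar>coord p\<bar> < 1/2"
  shows "\<bar>coord ((skew_map ^^ i) p)\<bar> \<le> max 0 (1/2 - 2 ^ i * (1/2 - \<bar>coord p\<bar>))"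
proof (induction i)
  case (Suc i)
  let ?q = "(skew_map ^^ i) p"
  have pos: "(0::real) < 2 ^ i * (1/2 - \<bar>coord p\<bar>)" using assms(2) by simp
  have "\<bar>coord ?q\<bar> \<le> 1/2" using Suc pos by linarith
  from coord_skew_map_small[OF skew_map_funpow_in_unit_square[OF assms(1)] this]
  have "\<bar>coord (skew_map ?q)\<bar> \<le> max 0 (2 * \<bar>coord ?q\<bar> - 1/2)" .
  moreover have "2 ^ Suc i * (1/2 - \<bar>coord p\<bar>) = 2 * (2 ^ i * (1/2 - \<bar>coord p\<bar>))" by simp
  ultimately show ?case using Suc pos by (simp only: funpow.simps comp_apply) linarith
qed (use assms in auto)

lemma coord_stays_small:
  assumes "p \<in> unit_square" "\<bar>coord p\<bar> < 1/2"
  shows "\<bar>coord ((skew_map ^^ i) p)\<bar> < 1/2"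
proof -
  have "(0::real) < 2 ^ i * (1/2 - \<bar>coord p\<bar>)" using assms(2) by simp
  then show ?thesis using coord_funpow_small[OF assms, of i] by linarith
qed

lemma coord_eventually_zero:
  assumes "p \<in> unit_square" "\<bar>coord p\<bar> < 1/2"
  shows "\<exists>N. \<forall>i\<ge>N. coord ((skew_map ^^ i) p) = 0"
proof -
  have d: "1/2 - \<bar>coord p\<bar> > 0" using assms(2) by simp
  obtain N where "(1/2) / (1/2 - \<bar>coord p\<bar>) < 2 ^ N" using real_arch_pow[of 2] by auto
  then have N: "1/2 < 2 ^ N * (1/2 - \<bar>coord p\<bar>)" using d by (simp add: field_simps)
  show ?thesis
  proof (intro exI allI impI)
    fix i assume "i \<ge> N"
    then have "(2::real) ^ N \<le> 2 ^ i" by simp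
    then have "2 ^ N * (1/2 - \<bar>coord p\<bar>) \<le> 2 ^ i * (1/2 - \<bar>coord p\<bar>)" using d by (intro mult_right_mono) auto
    then show "coord ((skew_map ^^ i) p) = 0" using coord_funpow_small[OF assms, of i] N by linarith
  qed
qed

text \<open>Vanishing squeeze only gives the bound 1/2, the edge of the attracted zone; the strict
  inequality comes from the damping \<open>\<bar>theta x\<bar> < 1\<close> off the strips.\<close>

lemma coord_skew_map_over_mid_gaps:
  assumes "p \<in> unit_square" "fst p \<in> mid_gaps"
  shows "\<bar>coord (skew_map p)\<bar> < 1/2"
proof -
  have "\<bar>coord (skew_map p)\<bar> = \<bar>theta (fst p)\<bar> * \<bar>fibre 0 (coord p)\<bar>"
    by (simp add: coord_skew_map skew_def squeeze_mid_gaps[OF assms(2)] abs_mult)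
  also have "\<dots> \<le> \<bar>theta (fst p)\<bar> * (1/2)"
    using fibre_range[of 0 "coord p"] by (intro mult_left_mono) auto
  also have "\<dots> < 1/2" using theta_mid_gaps[OF assms(2) unit_square_fst[OF assms(1)]] by simp
  finally show ?thesis .
qed

section \<open>Towers over the nested intervals and the phase of a point\<close>

definition tower :: "nat \<Rightarrow> real set" where
  "tower k = {x. \<exists>i. \<exists>w\<in>J k. x = (base ^^ i) w}"

lemma tower_0: "x \<in> {0..1} \<Longrightarrow> x \<in> tower 0"
  unfolding tower_def J_0 by (auto intro!: exI[of _ 0])

lemma tower_forward: "x \<in> tower k \<Longrightarrow> (base ^^ i) x \<in> tower k"
proof -
  assume "x \<in> tower k"
  then obtain j w where "w \<in> J k" "x = (base ^^ j) w" by (auto simp: tower_def)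
  moreover from this have "(base ^^ i) x = (base ^^ (i + j)) w" by (simp add: funpow_add)
  ultimately show ?thesis unfolding tower_def by blast
qed

lemma J_subset_tower: "J k \<subseteq> tower k"
  unfolding tower_def by (auto intro!: exI[of _ 0])

lemma tower_phase: "x \<in> tower k \<Longrightarrow> \<exists>i<2 ^ k. (base ^^ i) x \<in> J k"
proof -
  assume "x \<in> tower k"
  then obtain i w where w: "w \<in> J k" "x = (base ^^ i) w" by (auto simp: tower_def)
  obtain j where j: "j \<in> {i..<i + 2 ^ k}" "2 ^ k dvd j - 0" using residue_in_window[of 0 i "2 ^ k"] by auto
  have "(base ^^ (j - i)) x = (base ^^ j) w" using funpow_split[of i j base w] j w by simp
  then show ?thesis using base_J_mult[OF w(1)] j by (intro exI[of _ "j - i"]) auto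
qed

text \<open>\<open>base_return\<close> only looks forward from a visit. For \<open>b < a\<close> the
  membership in the tower is essential: it provides a visit before time \<open>2 ^ k\<close>, from
  which all visits are counted.\<close>

lemma return_iff:
  assumes x: "x \<in> tower k" and a: "(base ^^ a) x \<in> J k"
  shows "(base ^^ b) x \<in> J k \<longleftrightarrow> a mod 2 ^ k = b mod 2 ^ k"
proof -
  have fwd: "c mod 2 ^ k = d mod 2 ^ k" if "(base ^^ c) x \<in> J k" "(base ^^ d) x \<in> J k" "c \<le> d" for c d
    using that funpow_split[of c d base x] base_return[of "(base ^^ c) x" k "d - c"]
    by (metis mod_eq_dvd_iff_nat)
  show ?thesis
  proof
    assume "(base ^^ b) x \<in> J k"
    then show "a mod 2 ^ k = b mod 2 ^ k" using fwd[of a b] fwd[of b a] a by (metis nat_le_linear)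
  next
    assume eq: "a mod 2 ^ k = b mod 2 ^ k"
    obtain i where i: "i < 2 ^ k" "(base ^^ i) x \<in> J k" using tower_phase[OF x] by blast
    have "i mod 2 ^ k = a mod 2 ^ k" using fwd[of a i] fwd[of i a] a i by (metis nat_le_linear)
    then have i_eq: "i = b mod 2 ^ k" using i eq by simp
    then have "i \<le> b" by simp
    moreover have "2 ^ k dvd b - i" unfolding i_eq by (simp add: minus_mod_eq_mult_div)
    ultimately show "(base ^^ b) x \<in> J k"
      using base_J_mult[OF i(2)] funpow_split[of i b base x] by simp
  qed
qed

text \<open>The return map sends points of the open gap strictly below \<open>hi v\<close> in the
  chart, hence outside \<open>J (Suc v)\<close>.\<close>

lemma D_if_enters:
  assumes "y \<in> J v" "y \<notin> J (Suc v)" "(base ^^ (2 ^ v)) y \<in> J (Suc v)"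
  shows "y \<in> D v"
proof (rule ccontr)
  assume nD: "y \<notin> D v"
  obtain z where z: "y = chart v z" "0 \<le> z" "z \<le> 1" using assms(1) by (auto simp: J_def)
  have z_lt: "z < hi v" using assms(2) z by (force simp: J_Suc)
  have z_gt: "lo v < z" using nD z by (force simp: D_def)
  have "lo v * lo (Suc v) < hi v * 1"
    using lo_hi[of v] lo_hi[of "Suc v"] by (intro mult_strict_mono) auto
  then have "(hi v - lo v * lo (Suc v)) * (z - lo v) / (hi v - lo v) > 0" using z_gt lo_hi[of v] by simp
  then have "tower_map v z < hi v" using z_lt z_gt by (simp add: tower_map_gap)
  moreover have "chart v (tower_map v z) \<in> J (Suc v)" using assms(3) z by (simp add: base_chart)
  ultimately show False by (auto simp: J_Suc chart_inj)
qed

text \<open>Within distance \<open>2 ^ V\<close> of a visit to \<open>J V\<close>, the level of the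
  strip is the 2-adic valuation of the time difference. The sign there depends neither on
  \<open>x\<close> nor on \<open>V\<close>, which makes different windows comparable.\<close>

lemma theta_near_return:
  assumes x: "\<And>k. x \<in> tower k" and r: "(base ^^ r) x \<in> J V"
    and o: "t \<noteq> r" "t < r + 2 ^ V" "r < t + 2 ^ V"
  shows "theta ((base ^^ t) x) = (-1) ^ multiplicity 2 (max t r - min t r)"
proof -
  define i where "i = max t r - min t r"
  define v where "v = multiplicity 2 i"
  have i: "0 < i" "i < 2 ^ V" using o by (auto simp: i_def max_def min_def)
  have dvd_v: "2 ^ v dvd i" "\<not> 2 ^ Suc v dvd i"
    using i multiplicity_dvd[of 2 i] power_dvd_iff_le_multiplicity[of i 2 "Suc v"] by (auto simp: v_def)
  have "v < V"
    using dvd_v(1) i by (meson dvd_imp_le le_less_trans nat_power_less_imp_less pos2)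
  have iff: "(base ^^ t) x \<in> J k \<longleftrightarrow> 2 ^ k dvd i" if "k \<le> V" for k
  proof -
    have "(base ^^ r) x \<in> J k" using r J_mono[OF that] by blast
    then have "(base ^^ t) x \<in> J k \<longleftrightarrow> r mod 2 ^ k = t mod 2 ^ k" by (rule return_iff[OF x])
    also have "\<dots> \<longleftrightarrow> 2 ^ k dvd i"
      unfolding i_def max_def min_def using mod_eq_dvd_iff_nat[of t r "2 ^ k"] mod_eq_dvd_iff_nat[of r t "2 ^ k"]
      by (metis nat_le_linear)
    finally show ?thesis .
  qed
  let ?y = "(base ^^ t) x"
  have y: "?y \<in> J v" "?y \<notin> J (Suc v)" using iff[of v] iff[of "Suc v"] dvd_v \<open>v < V\<close> by auto
  have "?y \<in> tower (Suc v)" by (rule tower_forward[OF x])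
  then obtain \<rho> where rho: "\<rho> < 2 ^ Suc v" "(base ^^ \<rho>) ?y \<in> J (Suc v)" using tower_phase by blast
  have "(base ^^ \<rho>) ?y \<in> J v" using rho(2) J_Suc_subset by blast
  then have "2 ^ v dvd \<rho>" using base_return[OF y(1)] by blast
  moreover have "\<rho> \<noteq> 0" using rho(2) y(2) by (intro notI) simp
  ultimately have "\<rho> = 2 ^ v" using rho(1) by (elim dvdE) auto
  then have "?y \<in> D v" using D_if_enters[OF y] rho(2) by simp
  then show ?thesis using theta_D by (simp add: v_def i_def)
qed

lemma sgn_coord_skew_map:
  assumes "1/2 \<le> \<bar>coord p\<bar>"
  shows "sgn (coord (skew_map p)) = sgn (theta (fst p)) * sgn (coord p)"
proof -
  let ?s = "squeeze (fst p)"
  have pos: "fibre ?s w > 0" if "w \<ge> 1/2" for w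
    using that squeeze_bounds[of "fst p"] ear_range[of w] by (simp add: fibre_large add_pos_nonneg)
  have "sgn (fibre ?s (coord p)) = sgn (coord p)"
  proof (cases "coord p \<ge> 0")
    case True
    then show ?thesis using pos[of "coord p"] assms by simp
  next
    case False
    then show ?thesis using pos[of "- coord p"] assms by (simp add: fibre_odd)
  qed
  then show ?thesis by (simp add: coord_skew_map skew_def sgn_mult)
qed

lemma sgn_coord_funpow:
  assumes "\<And>t. t < n \<Longrightarrow> 1/2 \<le> \<bar>coord ((skew_map ^^ t) p)\<bar>"
  shows "sgn (coord ((skew_map ^^ n) p)) = (\<Prod>t<n. sgn (theta ((base ^^ t) (fst p)))) * sgn (coord p)"
  using assms by (induction n) (simp_all add: sgn_coord_skew_map fst_skew_map_funpow)

locale past_orbit =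
  fixes z :: "nat \<Rightarrow> real \<times> real" and n :: nat
  assumes z_square: "z j \<in> unit_square" and n_pos: "n > 0" and z_Suc: "(skew_map ^^ n) (z (Suc j)) = z j"
begin

lemma z_iter: "(skew_map ^^ (m * n)) (z (j + m)) = z j"
proof (induction m)
  case (Suc m)
  have "(skew_map ^^ (Suc m * n)) (z (j + Suc m)) = (skew_map ^^ (m * n)) ((skew_map ^^ n) (z (Suc (j + m))))"
  proof -
    have "Suc m * n = m * n + n" by simp
    then show ?thesis by (simp only: funpow_add comp_apply add_Suc_right)
  qed
  then show ?case using Suc by (simp add: z_Suc)
qed simp

lemma fst_z_iter: "(base ^^ (m * n)) (fst (z (j + m))) = fst (z j)"
  using z_iter[of m j] fst_skew_map_funpow by metis

lemma small_forward: "\<bar>coord ((skew_map ^^ t) (z (j + m)))\<bar> < 1/2 \<Longrightarrow> t \<le> m * n \<Longrightarrow> \<bar>coord (z j)\<bar> < 1/2"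
  using coord_stays_small[OF skew_map_funpow_in_unit_square[OF z_square], of t "j + m" "m * n - t"]
    funpow_split[of t "m * n" skew_map "z (j + m)"] z_iter[of m j] by simp

text \<open>Take the first level \<open>Suc k\<close> whose tower is left. A visit to
  \<open>J (Suc k)\<close> in the past would keep the orbit in that tower, so all earlier returns to
  \<open>J k\<close> avoid it, and a long enough past contains a passage over
  \<open>mid_gaps\<close>. This brings the coordinate into the middle half, where it stays.\<close>

lemma small_if_leaves_tower:
  assumes "fst (z j) \<notin> tower K"
  shows "\<bar>coord (z 0)\<bar> < 1/2"
proof -
  define K' where "K' = (LEAST K. \<exists>j. fst (z j) \<notin> tower K)"
  have ex: "\<exists>j. fst (z j) \<notin> tower K'" unfolding K'_def by (rule LeastI) (use assms in blast)
  then obtain j0 where j0: "fst (z j0) \<notin> tower K'" by blast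
  then have "K' \<noteq> 0" using tower_0[OF unit_square_fst[OF z_square]] by (intro notI) simp
  then obtain k where k: "K' = Suc k" by (cases K') auto
  have in_k: "fst (z j) \<in> tower k" for j
    using not_less_Least[of k "\<lambda>K. \<exists>j. fst (z j) \<notin> tower K"] k unfolding K'_def by auto
  \<comment> \<open>Room for fewer than \<open>2 ^ k\<close> steps to reach \<open>J k\<close>,
    three more returns and the step over \<open>mid_gaps\<close>.\<close>
  define m :: nat where "m = 5 * 2 ^ k"
  have long: "5 * 2 ^ k \<le> m * n" using n_pos by (simp add: m_def)
  let ?x = "fst (z (j0 + m))"
  obtain r where r: "r < 2 ^ k" "(base ^^ r) ?x \<in> J k" using tower_phase[OF in_k] by blast
  have out: "(base ^^ t) ?x \<notin> J (Suc k)" if "t \<le> m * n" for t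
  proof
    assume hit: "(base ^^ t) ?x \<in> J (Suc k)"
    have "(base ^^ (m * n - t)) ((base ^^ t) ?x) \<in> tower (Suc k)"
      by (rule tower_forward[OF subsetD[OF J_subset_tower hit]])
    then show False using funpow_split[OF that, of base ?x] fst_z_iter[of m j0] j0 k by simp
  qed
  have "(base ^^ r) ?x \<in> mid_gaps"
  proof (rule long_gap_stay[OF r(2)])
    fix i :: nat assume "i \<le> 3"
    then have "i * 2 ^ k \<le> 3 * 2 ^ k" by (intro mult_right_mono) auto
    then have "i * 2 ^ k + r \<le> m * n" using r long by linarith
    from out[OF this] show "(base ^^ (i * 2 ^ k)) ((base ^^ r) ?x) \<notin> J (Suc k)" by (simp add: funpow_add)
  qed
  then have "\<bar>coord ((skew_map ^^ Suc r) (z (j0 + m)))\<bar> < 1/2"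
    using coord_skew_map_over_mid_gaps[OF skew_map_funpow_in_unit_square[OF z_square], of r "j0 + m"]
    by (simp add: fst_skew_map_funpow)
  moreover have "Suc r \<le> m * n" using r(1) long by linarith
  ultimately have "\<bar>coord (z j0)\<bar> < 1/2" by (rule small_forward)
  then show ?thesis using small_forward[of 0 0 j0] by simp
qed

text \<open>Steps of length \<open>n\<close> preserve the phase modulo \<open>2 ^ K\<close>, the
  power of 2 in \<open>n\<close>; the odd part of \<open>n\<close> is invertible modulo
  \<open>2 ^ Suc V\<close>, so all compatible phases occur. Hence one offset \<open>r\<close> serves
  every \<open>V\<close>: the phase half a period away from \<open>J (Suc V)\<close> is attained
  there.\<close>

lemma visits_D:
  assumes tower: "\<And>j K. fst (z j) \<in> tower K"
  obtains r where "r < n" "\<And>V. n \<le> 2 ^ V \<Longrightarrow> \<exists>j. (base ^^ r) (fst (z (Suc j))) \<in> D V"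
proof -
  define K where "K = multiplicity 2 n"
  obtain m where m: "n = 2 ^ K * m" "odd m"
    using multiplicity_decompose'[of n 2] n_pos unfolding K_def by auto
  have "m \<ge> 1" using m by (cases m) auto
  obtain r where r: "r < 2 ^ K" "(base ^^ r) (fst (z 0)) \<in> J K" using tower_phase[OF tower] by blast
  have "\<exists>j. (base ^^ r) (fst (z (Suc j))) \<in> D V" if V: "n \<le> 2 ^ V" for V
  proof -
    have "2 ^ K \<le> (2 ^ V :: nat)" using V m \<open>m \<ge> 1\<close> by (metis dual_order.trans mult.right_neutral mult_le_mono2)
    then have "K \<le> V" by (simp add: power_le_imp_le_exp)
    obtain \<rho> where rho: "\<rho> < 2 ^ Suc V" "(base ^^ \<rho>) (fst (z 0)) \<in> J (Suc V)" using tower_phase[OF tower] by blast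
    have "(base ^^ \<rho>) (fst (z 0)) \<in> J K" using rho(2) J_mono[of K "Suc V"] \<open>K \<le> V\<close> by auto
    then have rmod: "r mod 2 ^ K = \<rho> mod 2 ^ K" using return_iff[OF tower r(2)] by blast
    \<comment> \<open>The number to which \<open>j * n\<close> must be congruent modulo
      \<open>2 ^ Suc V\<close>; the summand \<open>2 ^ Suc V\<close> keeps the natural subtraction
      of \<open>\<rho>\<close> exact.\<close>
    define e where "e = r + 2 ^ V + 2 ^ Suc V - \<rho>"
    have "2 ^ K dvd (2 ^ V + 2 ^ Suc V :: nat)" using \<open>K \<le> V\<close> by (intro dvd_add le_imp_power_dvd) auto
    then have "(r + (2 ^ V + 2 ^ Suc V)) mod 2 ^ K = \<rho> mod 2 ^ K" using rmod by (metis dvd_imp_mod_0 mod_add_right_eq add.right_neutral)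
    then have "2 ^ K dvd e" using rho(1) unfolding e_def by (metis add.assoc le_add2 less_imp_le mod_eq_dvd_iff_nat order_trans)
    then obtain d where d: "e = 2 ^ K * d" by blast
    have "coprime m (2 ^ Suc V)" using m(2) by (simp add: coprime_power_right_iff)
    then obtain x y where xy: "m * x = 2 ^ Suc V * y + 1"
      using bezout_nat[of m "2 ^ Suc V"] \<open>m \<ge> 1\<close> by auto
    \<comment> \<open>\<open>x\<close> inverts the odd part \<open>m\<close> modulo
      \<open>2 ^ Suc V\<close>; the added period makes \<open>j\<close> positive, as an index of the
      form \<open>Suc i\<close> is wanted.\<close>
    define j where "j = x * d + 2 ^ Suc V"
    have "j * n = 2 ^ K * d * (m * x) + 2 ^ Suc V * n" by (simp add: j_def m(1) algebra_simps)
    also have "\<dots> = e + 2 ^ Suc V * (e * y + n)" unfolding xy by (simp add: d algebra_simps)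
    finally have jn: "\<rho> + j * n = r + 2 ^ V + 2 ^ Suc V * (1 + (e * y + n))"
      using rho(1) by (simp add: e_def)
    have "(base ^^ (\<rho> + j * n)) (fst (z j)) = (base ^^ \<rho>) (fst (z 0))"
      using fst_z_iter[of j 0] by (simp add: funpow_add)
    then have "(base ^^ (\<rho> + j * n)) (fst (z j)) \<in> J (Suc V)" using rho(2) by simp
    moreover have "(\<rho> + j * n) mod 2 ^ Suc V = (r + 2 ^ V) mod 2 ^ Suc V" unfolding jn by (rule mod_mult_self2)
    ultimately have hit: "(base ^^ (r + 2 ^ V)) (fst (z j)) \<in> J (Suc V)" using return_iff[OF tower] by blast
    have "r mod 2 ^ Suc V \<noteq> (r + 2 ^ V) mod 2 ^ Suc V"
      using mod_eq_dvd_iff_nat[of r "r + 2 ^ V" "2 ^ Suc V"] by (auto simp: dvd_imp_le nat_dvd_not_less)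
    then have "(base ^^ r) (fst (z j)) \<notin> J (Suc V)" using return_iff[OF tower hit, of r] by auto
    moreover have "(base ^^ r) (fst (z j)) \<in> J V"
    proof -
      have "(base ^^ (r + 2 ^ V)) (fst (z j)) \<in> J V" using hit J_Suc_subset by blast
      then show ?thesis using return_iff[OF tower, of "r + 2 ^ V" j V r] by simp
    qed
    moreover have "(base ^^ (2 ^ V)) ((base ^^ r) (fst (z j))) \<in> J (Suc V)"
      using hit by (simp add: funpow_add add.commute[of r])
    ultimately have "(base ^^ r) (fst (z j)) \<in> D V" by (intro D_if_enters)
    moreover have "j \<noteq> 0" by (simp add: j_def)
    then obtain i where "j = Suc i" using not0_implies_Suc by blast
    ultimately show ?thesis by blast
  qed
  moreover have "2 ^ K * 1 \<le> n" unfolding m(1) using \<open>m \<ge> 1\<close> by (intro mult_le_mono2)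
  then have "r < n" using r(1) by simp
  ultimately show thesis using that by blast
qed

text \<open>Two windows of length \<open>n\<close> that meet \<open>D\<^sub>V\<close> and \<open>D\<^bsub>V+1\<^esub>\<close> at the same offset visit strips of
  equal levels at all other times. Hence one of them reverses the sign of the fibre coordinate.\<close>
lemma small_if_in_tower:
  assumes tower: "\<And>j K. fst (z j) \<in> tower K" and near: "\<And>i j. \<bar>coord (z i) - coord (z j)\<bar> < 1/2"
  shows "\<exists>j. \<bar>coord (z j)\<bar> < 1/2"
proof (rule ccontr)
  assume "\<not> ?thesis"
  then have large: "1/2 \<le> \<bar>coord (z j)\<bar>" for j by (simp add: not_less)
  have same_sgn: "sgn (coord (z i)) = sgn (coord (z j))" for i j
    using large[of i] large[of j] near[of i j] by (auto simp: sgn_if abs_if split: if_splits)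
  obtain r where r: "r < n" "\<And>V. n \<le> 2 ^ V \<Longrightarrow> \<exists>j. (base ^^ r) (fst (z (Suc j))) \<in> D V"
    using visits_D[OF tower] by metis
  define Q :: real where "Q = (\<Prod>t\<in>{..<n} - {r}. (-1) ^ multiplicity 2 (max t r - min t r))"
  have Q: "(-1) ^ V * Q = 1" if V: "n \<le> 2 ^ V" for V
  proof -
    obtain j where j: "(base ^^ r) (fst (z (Suc j))) \<in> D V" using r(2)[OF V] by blast
    let ?x = "fst (z (Suc j))"
    have "theta ((base ^^ t) ?x) = (-1) ^ multiplicity 2 (max t r - min t r)" if "t < n" "t \<noteq> r" for t
      using that r(1) V j D_subset_J by (intro theta_near_return[of _ r V] tower) auto
    then have "(\<Prod>t\<in>{..<n} - {r}. sgn (theta ((base ^^ t) ?x))) = Q"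
      unfolding Q_def by (intro prod.cong refl) (auto simp: minus_one_power_iff)
    moreover have "sgn (theta ((base ^^ r) ?x)) = (-1) ^ V" using theta_D[OF j] by (simp add: minus_one_power_iff)
    ultimately have prod: "(\<Prod>t<n. sgn (theta ((base ^^ t) ?x))) = (-1) ^ V * Q"
      using r(1) by (subst prod.remove[of _ r]) auto
    have "1/2 \<le> \<bar>coord ((skew_map ^^ t) (z (Suc j)))\<bar>" if "t < n" for t
      using small_forward[of t j 1] large[of j] that by fastforce
    from sgn_coord_funpow[of n, OF this]
    have "sgn (coord (z j)) = (-1) ^ V * Q * sgn (coord (z (Suc j)))" by (simp add: z_Suc prod)
    moreover have "sgn (coord (z (Suc j))) \<noteq> 0" using large[of "Suc j"] by (auto simp: sgn_if)
    ultimately show ?thesis using same_sgn[of j "Suc j"] by simp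
  qed
  have "n \<le> 2 ^ n" by (simp add: less_imp_le)
  moreover have "n \<le> 2 ^ Suc n" using \<open>n \<le> 2 ^ n\<close> unfolding power_Suc by linarith
  ultimately show False using Q[of n] Q[of "Suc n"] by simp
qed

end

lemma syndetic_far_cong:
  assumes "syndetic_far d" "\<And>i. i \<ge> N \<Longrightarrow> d i = d' i"
  shows "syndetic_far d'"
proof -
  obtain c P N' where c: "c > 0" "P > 0" "\<And>t. t \<ge> N' \<Longrightarrow> \<exists>i\<in>{t..<t + P}. c \<le> d i"
    using assms(1) unfolding syndetic_far_def by blast
  have "\<exists>i\<in>{t..<t + P}. c \<le> d' i" if "t \<ge> max N N'" for t
    using c(3)[of t] that assms(2) by force
  then show ?thesis unfolding syndetic_far_def using c by blast
qed

lemma rarely_far_cong: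
  assumes "rarely_far d" "\<And>i. i \<ge> N \<Longrightarrow> d i = d' i"
  shows "rarely_far d'"
  unfolding rarely_far_def
proof (intro allI impI)
  fix c :: real assume "c > 0"
  have lim: "(\<lambda>n. real (card {i. i < n \<and> c \<le> d i}) / real n + real N * (1 / real n)) \<longlonglongrightarrow> 0 + real N * 0"
    using assms(1) \<open>c > 0\<close> unfolding rarely_far_def by (intro tendsto_intros lim_1_over_n) auto
  show "(\<lambda>n. real (card {i. i < n \<and> c \<le> d' i}) / real n) \<longlonglongrightarrow> 0"
  proof (rule tendsto_sandwich[OF _ _ tendsto_const lim[simplified]])
    have "card {i. i < n \<and> c \<le> d' i} \<le> card {i. i < n \<and> c \<le> d i} + N" for n
    proof -
      have "card {i. i < n \<and> c \<le> d' i} \<le> card ({i. i < n \<and> c \<le> d i} \<union> {..<N})"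
        using assms(2) by (intro card_mono) (auto simp: not_less)
      also have "\<dots> \<le> card {i. i < n \<and> c \<le> d i} + card {..<N}" by (rule card_Un_le)
      finally show ?thesis by simp
    qed
    then have "real (card {i. i < n \<and> c \<le> d' i}) \<le> real (card {i. i < n \<and> c \<le> d i}) + real N" for n
      by (metis of_nat_add of_nat_le_iff)
    then show "\<forall>\<^sub>F n in sequentially. real (card {i. i < n \<and> c \<le> d' i}) / real n
        \<le> real (card {i. i < n \<and> c \<le> d i}) / real n + real N / real n"
      by (intro always_eventually allI) (simp add: add_divide_distrib[symmetric] divide_right_mono)
  qed auto
qed

lemma no_DC2_point: "\<not> DC2_point unit_square skew_map x\<^sub>0"
proof
  assume "DC2_point unit_square skew_map x\<^sub>0"
  then obtain S n A where S: "uncountable S" "DC2_scrambled unit_square skew_map S" "n > 0"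
    "closedin (top_of_set unit_square) A" "S \<subseteq> A" "A \<subseteq> (skew_map ^^ n) ` A" "(skew_map ^^ n) ` A \<subseteq> ball x\<^sub>0 (1/8)"
    unfolding DC2_point_def by (metis zero_less_divide_1_iff zero_less_numeral)
  have A_sq: "A \<subseteq> unit_square" using S(4) by (auto dest: closedin_imp_subset)
  have dies: "\<exists>N. \<forall>i\<ge>N. coord ((skew_map ^^ i) p) = 0" if "p \<in> S" for p
  proof -
    obtain pre where pre: "\<And>a. a \<in> A \<Longrightarrow> pre a \<in> A \<and> (skew_map ^^ n) (pre a) = a"
      using S(6) by (metis image_iff subsetD)
    define z where "z j = (pre ^^ j) p" for j
    have zA: "z j \<in> A" for j
      by (induction j) (use that S(5) pre in \<open>auto simp: z_def\<close>)
    interpret past_orbit z n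
    proof
      show "z j \<in> unit_square" for j using zA A_sq by blast
      show "(skew_map ^^ n) (z (Suc j)) = z j" for j using pre[OF zA[of j]] by (simp add: z_def)
    qed (rule S(3))
    \<comment> \<open>Radius 1/8 gives distance below 1/4 in the square, and \<open>coord\<close>
      doubles the second component.\<close>
    have near: "\<bar>coord (z i) - coord (z j)\<bar> < 1/2" for i j
    proof -
      have "z i \<in> ball x\<^sub>0 (1/8)" "z j \<in> ball x\<^sub>0 (1/8)" using zA S(6,7) by blast+
      then have "dist (z i) (z j) < 1/8 + 1/8"
        by (metis dist_commute dist_triangle_less_add mem_ball)
      moreover have "dist (snd (z i)) (snd (z j)) \<le> dist (z i) (z j)" by (rule dist_snd_le)
      ultimately show ?thesis by (simp add: coord_def dist_real_def abs_if split: if_splits)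
    qed
    have "\<bar>coord (z 0)\<bar> < 1/2"
    proof (cases "\<forall>j K. fst (z j) \<in> tower K")
      case True
      then obtain j where "\<bar>coord (z j)\<bar> < 1/2" using small_if_in_tower near by blast
      then show ?thesis using small_forward[of 0 0 j] by simp
    qed (use small_if_leaves_tower in blast)
    then show ?thesis using coord_eventually_zero[OF z_square[of 0]] by (simp add: z_def)
  qed
  obtain p q where pq: "p \<in> S" "q \<in> S" "p \<noteq> q"
    using S(1) by (metis countable_empty countable_insert insertI1 insert_absorb is_singletonI' is_singleton_def)
  obtain N1 N2 where N: "\<And>i. i \<ge> N1 \<Longrightarrow> coord ((skew_map ^^ i) p) = 0" "\<And>i. i \<ge> N2 \<Longrightarrow> coord ((skew_map ^^ i) q) = 0"
    using dies[OF pq(1)] dies[OF pq(2)] by blast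
  have d: "\<bar>(base ^^ i) (fst p) - (base ^^ i) (fst q)\<bar> = dist ((skew_map ^^ i) p) ((skew_map ^^ i) q)" if "i \<ge> max N1 N2" for i
  proof -
    have "snd ((skew_map ^^ i) p) = snd ((skew_map ^^ i) q)" using N(1)[of i] N(2)[of i] that by (simp add: coord_def)
    then show ?thesis by (simp add: dist_prod_def fst_skew_map_funpow dist_real_def)
  qed
  have "fst p \<in> {0..1}" "fst q \<in> {0..1}" using pq S(5) A_sq unit_square_fst by blast+
  then have "\<not> DC2_pair skew_map p q"
    using base_pair_dichotomy[of "fst p" "fst q"]
      syndetic_far_cong[of _ "max N1 N2" "\<lambda>i. dist ((skew_map ^^ i) p) ((skew_map ^^ i) q)", OF _ d]
      rarely_far_cong[of _ "max N1 N2" "\<lambda>i. dist ((skew_map ^^ i) p) ((skew_map ^^ i) q)", OF _ d]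
      not_DC2_pair_if_syndetic_far[of skew_map p q] not_DC2_pair_if_rarely_far[of skew_map p q] by blast
  then show False using S(2) pq by (auto simp: DC2_scrambled_def)
qed

section \<open>Symbolic coding over the orbit of 0\<close>

text \<open>The successor appears because the orbit of 0 meets \<open>J k\<close> exactly at the
  times congruent to -1 modulo \<open>2 ^ k\<close>, starting with \<open>2 ^ k - 1\<close>
  (\<open>base_orbit_end\<close>).\<close>

abbreviation level :: "nat \<Rightarrow> nat" where "level t \<equiv> multiplicity 2 (Suc t)"

lemma base_orbit_end: "(base ^^ (2 ^ k - 1)) 0 = chart k 0"
proof (induction k)
  case 0
  then show ?case by (simp add: chart_0)
next
  case (Suc k)
  have "2 ^ Suc k - 1 = 2 ^ k + (2 ^ k - 1 :: nat)" by simp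
  then have "(base ^^ (2 ^ Suc k - 1)) 0 = (base ^^ (2 ^ k)) (chart k 0)"
    using Suc by (simp only: funpow_add comp_apply)
  also have "\<dots> = chart (Suc k) 0" by (simp add: base_chart tower_map_0 chart_Suc)
  finally show ?case .
qed

lemma base_orbit_in_D: "(base ^^ t) 0 \<in> D (level t)"
proof -
  define k where "k = level t"
  obtain m where m: "Suc t = 2 ^ k * m" "odd m"
    using multiplicity_decompose'[of "Suc t" 2] unfolding k_def by auto
  then obtain j where j: "m = 2 * j + 1" by (auto elim: oddE)
  have "(2::nat) ^ k \<ge> 1" by simp
  then have t: "t = j * 2 ^ Suc k + (2 ^ k - 1)" using m(1) unfolding j by (simp add: algebra_simps)
  have "(base ^^ (i * 2 ^ Suc k)) x \<in> D k" if "x \<in> D k" for i x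
  proof (induction i)
    case (Suc i)
    have "Suc i * 2 ^ Suc k = 2 ^ k + (2 ^ k + i * 2 ^ Suc k)" by simp
    then have "(base ^^ (Suc i * 2 ^ Suc k)) x = (base ^^ (2 ^ k)) ((base ^^ (2 ^ k)) ((base ^^ (i * 2 ^ Suc k)) x))"
      by (simp only: funpow_add comp_apply)
    then show ?case using base_J_Suc[OF base_D[OF Suc]] by simp
  qed (use that in simp)
  moreover have "chart k 0 \<in> D k" using lo_hi[of k] by (auto simp: D_def)
  moreover have "(base ^^ t) 0 = (base ^^ (j * 2 ^ Suc k)) (chart k 0)"
    by (subst t) (simp only: funpow_add comp_apply base_orbit_end)
  ultimately show ?thesis unfolding k_def[symmetric] by simp
qed

definition sq :: "nat \<Rightarrow> real" where "sq t = squeeze ((base ^^ t) 0)"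

text \<open>The truncation is intended: levels 0 and 1 both cost nothing, since
  \<open>squeeze\<close> is 1 on \<open>D 0\<close> and \<open>D 1\<close>.\<close>

abbreviation delay :: "nat \<Rightarrow> nat" where "delay t \<equiv> level t - 1"

lemma sq_bounds: "(1/3) ^ delay t \<le> sq t" "0 < sq t" "sq t \<le> 1"
proof -
  show 1: "(1/3) ^ delay t \<le> sq t" unfolding sq_def by (rule squeeze_D[OF base_orbit_in_D])
  show "sq t \<le> 1" unfolding sq_def by (rule squeeze_bounds)
  have "(0::real) < (1/3) ^ delay t" by simp
  with 1 show "0 < sq t" by linarith
qed

text \<open>This is \<open>ear\<close> in the coordinate \<open>e = 2 * w - 1\<close> of the outer
  quarter. Each outer third is mapped onto the unit interval with slope 3 or -3; these thirds carry
  the two symbols.\<close>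

definition trapezoid :: "real \<Rightarrow> real" where
  "trapezoid e = max 0 (min 1 (3/2 * (1 - \<bar>2 * e - 1\<bar>)))"

lemma trapezoid_left: "0 \<le> e \<Longrightarrow> e \<le> 1/3 \<Longrightarrow> trapezoid e = 3 * e"
  and trapezoid_right: "2/3 \<le> e \<Longrightarrow> e \<le> 1 \<Longrightarrow> trapezoid e = 3 * (1 - e)"
  and trapezoid_range: "0 \<le> trapezoid e" "trapezoid e \<le> 1"
  by (auto simp: trapezoid_def)

primrec ear_orbit :: "nat \<Rightarrow> real \<Rightarrow> real" where
  "ear_orbit 0 e = e"
| "ear_orbit (Suc t) e = sq t * trapezoid (ear_orbit t e)"

lemma ear_orbit_range: "e \<in> {0..1} \<Longrightarrow> ear_orbit t e \<in> {0..1}"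
  using sq_bounds(2,3) trapezoid_range by (cases t) (auto intro!: mult_le_one simp: less_imp_le)

lemma continuous_on_ear_orbit: "continuous_on A (ear_orbit t)"
proof (induction t)
  case 0
  then show ?case by (simp add: ear_orbit.simps(1)[abs_def])
next
  case (Suc t)
  then show ?case unfolding ear_orbit.simps(2)[abs_def] trapezoid_def by (intro continuous_intros)
qed

definition pt :: "real \<Rightarrow> real \<times> real" where "pt e = (0, (3 + e) / 4)"

lemma pt_in_unit_square: "e \<in> {0..1} \<Longrightarrow> pt e \<in> unit_square"
  by (auto simp: pt_def unit_square_def)

lemma fst_pt_orbit: "fst ((skew_map ^^ t) (pt e)) = (base ^^ t) 0"
  by (simp add: fst_skew_map_funpow pt_def)

lemma fibre_sign: "\<sigma> = 1 \<or> \<sigma> = -1 \<Longrightarrow> fibre s (\<sigma> * w) = \<sigma> * fibre s w"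
  by (auto simp: fibre_odd)

text \<open>Over the strips the sign is 1 or -1, and the fibre maps are odd; so all signs can be
  collected in front of the unsigned dynamics \<open>ear_orbit\<close>.\<close>

lemma coord_pt_orbit:
  assumes "e \<in> {0..1}"
  shows "coord ((skew_map ^^ t) (pt e)) = (\<Prod>i<t. (-1) ^ level i) * ((1 + ear_orbit t e) / 2)"
proof (induction t)
  case 0
  then show ?case by (simp add: coord_def pt_def field_simps)
next
  case (Suc t)
  define \<sigma> :: real where "\<sigma> = (\<Prod>i<t. (-1) ^ level i)"
  define E where "E = ear_orbit t e"
  have E: "0 \<le> E" using ear_orbit_range[OF assms, of t] by (simp add: E_def)
  have "\<sigma> = 1 \<or> \<sigma> = -1" unfolding \<sigma>_def by (induction t) (auto simp: minus_one_power_iff)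
  moreover have "fibre (sq t) ((1 + E) / 2) = (1 + sq t * trapezoid E) / 2"
  proof -
    have "4 * ((1 + E) / 2) - 3 = 2 * E - 1" by simp
    then have "ear ((1 + E) / 2) = trapezoid E" by (simp only: ear_def trapezoid_def)
    then show ?thesis using E by (simp add: fibre_large field_simps)
  qed
  ultimately have "fibre (sq t) (\<sigma> * ((1 + E) / 2)) = \<sigma> * ((1 + sq t * trapezoid E) / 2)"
    by (metis fibre_sign)
  moreover have "coord ((skew_map ^^ t) (pt e)) = \<sigma> * ((1 + E) / 2)"
    using Suc by (simp only: \<sigma>_def E_def)
  then have "coord ((skew_map ^^ Suc t) (pt e)) = (-1) ^ level t * fibre (sq t) (\<sigma> * ((1 + E) / 2))"
    by (simp only: funpow.simps comp_apply coord_skew_map fst_pt_orbit skew_def theta_D[OF base_orbit_in_D] sq_def)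
  ultimately show ?case by (simp add: \<sigma>_def E_def)
qed

lemma sign_cases: "(\<Prod>i<t. (-1) ^ level i) = (1::real) \<or> (\<Prod>i<t. (-1) ^ level i) = (-1::real)"
  by (induction t) (auto simp: minus_one_power_iff)

lemma abs_coord_pt_orbit: "e \<in> {0..1} \<Longrightarrow> \<bar>coord ((skew_map ^^ t) (pt e))\<bar> = (1 + ear_orbit t e) / 2"
  using sign_cases[of t] ear_orbit_range[of e t] by (auto simp: coord_pt_orbit)

text \<open>Both orbits lie over the orbit of 0 and carry the same sign, so only the ear coordinates
  differ.\<close>

lemma dist_pt_orbits:
  assumes "e \<in> {0..1}" "e' \<in> {0..1}"
  shows "dist ((skew_map ^^ t) (pt e)) ((skew_map ^^ t) (pt e')) = \<bar>ear_orbit t e - ear_orbit t e'\<bar> / 4"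
proof -
  let ?p = "(skew_map ^^ t) (pt e)" and ?q = "(skew_map ^^ t) (pt e')"
  have "dist ?p ?q = \<bar>snd ?p - snd ?q\<bar>" by (simp add: dist_prod_def fst_pt_orbit dist_real_def)
  also have "\<dots> = \<bar>coord ?p - coord ?q\<bar> / 2" by (simp add: coord_def abs_if)
  also have "\<dots> = \<bar>ear_orbit t e - ear_orbit t e'\<bar> / 4"
  proof -
    have diff: "coord ?p - coord ?q = (\<Prod>i<t. (-1) ^ level i) * ((ear_orbit t e - ear_orbit t e') / 2)"
      unfolding coord_pt_orbit[OF assms(1)] coord_pt_orbit[OF assms(2)] right_diff_distrib[symmetric]
      by (simp add: diff_divide_distrib[symmetric])
    have "\<bar>\<Prod>i<t. (-1) ^ level i :: real\<bar> = 1" using sign_cases[of t] by auto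
    then show ?thesis unfolding diff abs_mult by simp
  qed
  finally show ?thesis .
qed

text \<open>At time \<open>t\<close> the coded points fill an interval of length \<open>3\<close> to the power \<open>- pending t\<close>, and a
  step over \<open>D\<^sub>k\<close> contracts by another \<open>3\<close> to the power \<open>k - 1\<close>. A new binary symbol is read off
  only at the times with \<open>pending t = 0\<close>, which have density at least \<open>1/2\<close>.\<close>
primrec pending :: "nat \<Rightarrow> nat" where
  "pending 0 = 0"
| "pending (Suc t) = (pending t - 1) + delay t"

definition free_times :: "nat \<Rightarrow> nat set" where "free_times n = {t. t < n \<and> pending t = 0}"

lemma free_times_Suc: "free_times (Suc n) = (if pending n = 0 then insert n (free_times n) else free_times n)"
  by (auto simp: free_times_def less_Suc_eq)

lemma finite_free_times: "finite (free_times n)" by (simp add: free_times_def)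

text \<open>Apart from the added delays, \<open>pending\<close> drops by one in every step except at
  the free times, where truncation leaves it at 0.\<close>

lemma pending_balance: "pending n + n = (\<Sum>t<n. delay t) + card (free_times n)"
proof (induction n)
  case 0
  then show ?case by (simp add: free_times_def)
next
  case (Suc n)
  have "n \<notin> free_times n" by (simp add: free_times_def)
  then show ?case using Suc finite_free_times[of n] by (auto simp: free_times_Suc)
qed

lemma level_odd: "even n \<Longrightarrow> level n = 0"
  by (intro not_dvd_imp_multiplicity_0) simp

lemma level_even: "level (Suc (2 * n)) = Suc (level n)"
proof -
  have "Suc (Suc (2 * n)) = 2 * Suc n" by simp
  moreover have "multiplicity 2 (2 * Suc n) = Suc (level n)"
    by (rule multiplicity_times_same) simp_all
  ultimately show ?thesis by (simp only:)
qed

text \<open>The sum is the exponent of 2 in \<open>fact n\<close>; the recursion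
  \<open>split\<close> is Legendre's formula.\<close>

lemma sum_level_le: "(\<Sum>t<n. level t) \<le> n"
proof (induction n rule: less_induct)
  case (less n)
  have split: "(\<Sum>t<m. level t) = m div 2 + (\<Sum>t<m div 2. level t)" for m
  proof (induction m)
    case (Suc m)
    then show ?case
      by (cases "even m") (auto simp: level_odd level_even elim!: evenE oddE)
  qed simp
  show ?case
  proof (cases "n = 0")
    case False
    then have "(\<Sum>t<n div 2. level t) \<le> n div 2" by (intro less) simp
    then show ?thesis using split[of n] by linarith
  qed simp
qed

text \<open>The delay is 0 at even times and \<open>level i\<close> at the odd time
  \<open>2 * i + 1\<close>, so the sum reduces to one over half the range.\<close>

lemma sum_delay: "2 * (\<Sum>t<n. delay t) \<le> n"
proof -
  have "(\<Sum>t<n. delay t) = (\<Sum>t<n div 2. level t)"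
  proof (induction n)
    case (Suc n)
    then show ?case
      by (cases "even n") (auto simp: level_odd level_even elim!: evenE oddE)
  qed simp
  then show ?thesis using sum_level_le[of "n div 2"] by simp
qed

lemma card_free_times: "n \<le> 2 * card (free_times n)"
  using pending_balance[of n] sum_delay[of n] by linarith

definition target :: "(nat \<Rightarrow> bool) \<Rightarrow> nat \<Rightarrow> real set" where
  "target b t = (if pending t = 0 then (if b t then {2/3..1} else {0..1/3}) else {0..(1/3) ^ pending t})"

lemma target_unit: "target b t \<subseteq> {0..(1/3) ^ pending t}"
  by (auto simp: target_def)

lemma target_nonfree: "pending t \<noteq> 0 \<Longrightarrow> target b t \<subseteq> {0..1/3}"
proof -
  assume "pending t \<noteq> 0"
  then obtain m where "pending t = Suc m" by (cases "pending t") auto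
  moreover have "(1/3::real) ^ m \<le> 1" by (simp add: power_le_one)
  ultimately show ?thesis by (auto simp: target_def)
qed

lemma closed_target: "closed (target b t)" by (simp add: target_def)

text \<open>A branch of \<open>trapezoid\<close> expands by 3, which uses up one pending factor or,
  at a free time, covers the unit interval from a third of it. Multiplication by \<open>sq t\<close>
  costs at most the factor 3 to the power \<open>delay t\<close>, as recorded in
  \<open>pending (Suc t)\<close>.\<close>

lemma target_covers:
  assumes v: "v \<in> target b (Suc t)"
  shows "\<exists>e\<in>target b t. sq t * trapezoid e = v"
proof -
  define u where "u = v / sq t"
  have v: "0 \<le> v" "v \<le> (1/3) ^ pending (Suc t)" using v target_unit[of b "Suc t"] by auto
  have "v \<le> (1/3) ^ (pending t - 1) * (1/3) ^ delay t" using v(2) by (simp add: power_add)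
  also have "\<dots> \<le> (1/3) ^ (pending t - 1) * sq t" using sq_bounds(1)[of t] by (intro mult_left_mono) auto
  finally have u_le: "u \<le> (1/3) ^ (pending t - 1)" using sq_bounds(2)[of t] by (simp add: u_def field_simps)
  have u: "0 \<le> u" "sq t * u = v" using v(1) sq_bounds(2)[of t] by (auto simp: u_def)
  have "(1/3::real) ^ (pending t - 1) \<le> 1" by (simp add: power_le_one)
  then have "u \<le> 1" using u_le by linarith
  show ?thesis
  proof (cases "pending t = 0")
    case True
    show ?thesis
    proof (cases "b t")
      case True
      then show ?thesis using \<open>pending t = 0\<close> u \<open>u \<le> 1\<close>
        by (intro bexI[of _ "1 - u / 3"]) (auto simp: target_def trapezoid_right)
    next
      case False
      then show ?thesis using \<open>pending t = 0\<close> u \<open>u \<le> 1\<close>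
        by (intro bexI[of _ "u / 3"]) (auto simp: target_def trapezoid_left)
    qed
  next
    case False
    then obtain m where m: "pending t = Suc m" by (cases "pending t") auto
    then show ?thesis using u u_le \<open>u \<le> 1\<close>
      by (intro bexI[of _ "u / 3"]) (auto simp: target_def trapezoid_left)
  qed
qed

text \<open>The covering relations allow finite codes to be pulled back from their last time;
  compactness passes to the infinite code.\<close>

lemma code_realised:
  obtains e where "e \<in> {0..1}" "\<And>t. ear_orbit t e \<in> target b t"
proof -
  have fin: "\<exists>e\<in>{0..1}. (\<forall>t\<le>n. ear_orbit t e \<in> target b t) \<and> ear_orbit n e = v" if "v \<in> target b n" for n v
    using that
  proof (induction n arbitrary: v)
    case 0
    then show ?case using target_unit[of b 0] by (intro bexI[of _ v]) auto
  next
    case (Suc n)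
    then obtain u where u: "u \<in> target b n" "sq n * trapezoid u = v" using target_covers by blast
    obtain e where "e \<in> {0..1}" "\<forall>t\<le>n. ear_orbit t e \<in> target b t" "ear_orbit n e = u"
      using Suc.IH[OF u(1)] by blast
    then show ?case using u Suc.prems by (intro bexI[of _ e]) (auto simp: le_Suc_eq)
  qed
  define K where "K n = {e \<in> {0..1}. \<forall>t\<le>n. ear_orbit t e \<in> target b t}" for n
  have "\<Inter>(range K) \<noteq> {}"
  proof (rule compact_nest)
    fix n
    have "K n = {0..1} \<inter> (\<Inter>t\<in>{..n}. ear_orbit t -` target b t)" by (auto simp: K_def)
    moreover have "closed (ear_orbit t -` target b t)" for t
      using continuous_on_ear_orbit[of UNIV t] closed_target by (simp add: continuous_closed_vimage continuous_on_eq_continuous_at)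
    ultimately show "compact (K n)" by (auto intro!: compact_Int_closed closed_INT)
    have "target b n \<noteq> {}" by (auto simp: target_def)
    then obtain v where "v \<in> target b n" by blast
    from fin[OF this] show "K n \<noteq> {}" by (auto simp: K_def)
  next
    show "K n \<subseteq> K m" if "m \<le> n" for m n using that by (auto simp: K_def)
  qed
  then obtain e where "\<And>n. e \<in> K n" by blast
  then show thesis using that[of e] by (auto simp: K_def)
qed

definition sol :: "(nat \<Rightarrow> bool) \<Rightarrow> real" where
  "sol b = (SOME e. e \<in> {0..1} \<and> (\<forall>t. ear_orbit t e \<in> target b t))"

lemma sol: "sol b \<in> {0..1}" "ear_orbit t (sol b) \<in> target b t"
proof -
  have "\<exists>e. e \<in> {0..1} \<and> (\<forall>t. ear_orbit t e \<in> target b t)" using code_realised[of b] by metis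
  from someI_ex[OF this] show "sol b \<in> {0..1}" "ear_orbit t (sol b) \<in> target b t" unfolding sol_def by auto
qed

lemma free_separation:
  assumes "pending t = 0" "b t \<noteq> b' t"
  shows "1/3 \<le> \<bar>ear_orbit t (sol b) - ear_orbit t (sol b')\<bar>"
  using sol(2)[of t b] sol(2)[of t b'] assms by (auto simp: target_def split: if_splits)

text \<open>While the codes agree, both orbits use the same branch and a step multiplies their
  distance by \<open>3 * sq t\<close>. The distance is at most 1 at time \<open>n\<close>, so going
  backwards it is small unless the delays compensate.\<close>

lemma agreement_contracts:
  assumes "t \<le> n" "\<And>i. t \<le> i \<Longrightarrow> i < n \<Longrightarrow> b i = b' i"
  shows "3 ^ (n - t) * \<bar>ear_orbit t (sol b) - ear_orbit t (sol b')\<bar> \<le> 3 ^ (\<Sum>i\<in>{t..<n}. delay i)"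
  using assms
proof (induction t rule: inc_induct)
  case base
  then show ?case using ear_orbit_range[OF sol(1), of n b] ear_orbit_range[OF sol(1), of n b'] by auto
next
  case (step t)
  let ?e = "ear_orbit t (sol b)" and ?e' = "ear_orbit t (sol b')"
  have "b t = b' t" using step by simp
  then have "(?e \<in> {0..1/3} \<and> ?e' \<in> {0..1/3}) \<or> (?e \<in> {2/3..1} \<and> ?e' \<in> {2/3..1})"
    using sol(2)[of t b] sol(2)[of t b'] target_nonfree[of t b] target_nonfree[of t b']
    by (cases "pending t = 0") (auto simp: target_def)
  then have "\<bar>trapezoid ?e - trapezoid ?e'\<bar> = 3 * \<bar>?e - ?e'\<bar>"
    by (auto simp: trapezoid_left trapezoid_right abs_if)
  then have "\<bar>ear_orbit (Suc t) (sol b) - ear_orbit (Suc t) (sol b')\<bar> = sq t * (3 * \<bar>?e - ?e'\<bar>)"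
    using sq_bounds(2)[of t] by (simp add: right_diff_distrib[symmetric] abs_mult)
  also have "\<dots> \<ge> (1/3) ^ delay t * (3 * \<bar>?e - ?e'\<bar>)" using sq_bounds(1) by (intro mult_right_mono) auto
  finally have "3 * \<bar>?e - ?e'\<bar> \<le> 3 ^ delay t * \<bar>ear_orbit (Suc t) (sol b) - ear_orbit (Suc t) (sol b')\<bar>"
    by (simp add: power_divide field_simps del: ear_orbit.simps)
  then have "3 ^ (n - Suc t) * (3 * \<bar>?e - ?e'\<bar>)
      \<le> 3 ^ (n - Suc t) * (3 ^ delay t * \<bar>ear_orbit (Suc t) (sol b) - ear_orbit (Suc t) (sol b')\<bar>)"
    by (intro mult_left_mono) auto
  also have "\<dots> = 3 ^ delay t * (3 ^ (n - Suc t) * \<bar>ear_orbit (Suc t) (sol b) - ear_orbit (Suc t) (sol b')\<bar>)"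
    by (simp only: ac_simps)
  also have "\<dots> \<le> 3 ^ delay t * 3 ^ (\<Sum>i\<in>{Suc t..<n}. delay i)"
    using step by (intro mult_left_mono step.IH) auto
  also have "\<dots> = 3 ^ (\<Sum>i\<in>{t..<n}. delay i)"
    using step.hyps by (simp add: power_add[symmetric] sum.atLeast_Suc_lessThan)
  also have "3 ^ (n - Suc t) * (3 * \<bar>?e - ?e'\<bar>) = 3 ^ (n - t) * \<bar>?e - ?e'\<bar>"
  proof -
    have "n - t = Suc (n - Suc t)" using step.hyps by simp
    then show ?thesis by simp
  qed
  finally show ?case .
qed

text \<open>The delays before time \<open>n\<close> add up to at most n/2, so a net exponent of at
  least n/2 - t, hence at least \<open>R\<close>, remains.\<close>

lemma agreement_close:
  assumes agree: "\<And>i. t \<le> i \<Longrightarrow> i < n \<Longrightarrow> b i = b' i" and R: "2 * t + 2 * R \<le> n"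
  shows "\<bar>ear_orbit t (sol b) - ear_orbit t (sol b')\<bar> \<le> (1/3) ^ R"
proof -
  let ?d = "\<bar>ear_orbit t (sol b) - ear_orbit t (sol b')\<bar>"
  define s where "s = (\<Sum>i\<in>{t..<n}. delay i)"
  have "s \<le> (\<Sum>i<n. delay i)" unfolding s_def by (intro sum_mono2) auto
  then have le: "s + R \<le> n - t" using sum_delay[of n] R by linarith
  have "3 ^ (s + R) * ?d \<le> 3 ^ (n - t) * ?d" using le by (intro mult_right_mono power_increasing) auto
  also have "\<dots> \<le> 3 ^ s" unfolding s_def using R by (intro agreement_contracts agree) auto
  finally have "3 ^ R * ?d \<le> 1" by (simp add: power_add)
  then show ?thesis by (simp add: power_divide field_simps)
qed

section \<open>Chaos and positive entropy\<close>

text \<open>Two different sequences \<open>\<alpha>\<close> give the same code on the even blocks and, on infinitely many odd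
  blocks, codes that differ at every time; each block is long compared with its past.\<close>
definition block_code :: "(nat \<Rightarrow> bool) \<Rightarrow> nat \<Rightarrow> bool" where
  "block_code \<alpha> t \<longleftrightarrow> (\<exists>j. fact (2 * j + 1) \<le> t \<and> t < fact (2 * j + 2) \<and> \<alpha> (fst (prod_decode j)))"

lemma same_block:
  assumes "fact i \<le> t" "t < fact (Suc i)" "fact j \<le> t" "t < (fact (Suc j) :: nat)"
  shows "i = j"
proof -
  have "\<not> i < j"
  proof
    assume "i < j"
    then have "(fact (Suc i) :: nat) \<le> fact j" by (intro fact_mono_nat) simp
    then show False using assms by linarith
  qed
  moreover have "\<not> j < i"
  proof
    assume "j < i"
    then have "(fact (Suc j) :: nat) \<le> fact i" by (intro fact_mono_nat) simp
    then show False using assms by linarith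
  qed
  ultimately show ?thesis by simp
qed

lemma block_code_odd:
  assumes "fact (2 * j + 1) \<le> t" "t < fact (2 * j + 2)"
  shows "block_code \<alpha> t \<longleftrightarrow> \<alpha> (fst (prod_decode j))"
proof -
  have "i = j" if "fact (2 * i + 1) \<le> t" "t < fact (2 * i + 2)" for i
    using same_block[of "2 * i + 1" t "2 * j + 1"] that assms by simp
  then show ?thesis unfolding block_code_def using assms by metis
qed

lemma block_code_even:
  assumes "fact (2 * j) \<le> t" "t < fact (2 * j + 1)"
  shows "\<not> block_code \<alpha> t"
proof
  assume "block_code \<alpha> t"
  then obtain i where "fact (2 * i + 1) \<le> t" "t < fact (2 * i + 2)" by (auto simp: block_code_def)
  then have "2 * i + 1 = 2 * j" using same_block[of "2 * i + 1" t "2 * j"] assms by simp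
  then show False by presburger
qed

definition coded_point :: "(nat \<Rightarrow> bool) \<Rightarrow> real \<times> real" where
  "coded_point \<alpha> = pt (sol (block_code \<alpha>))"

lemma coded_point_in_unit_square: "coded_point \<alpha> \<in> unit_square"
  unfolding coded_point_def by (rule pt_in_unit_square[OF sol(1)])

lemma Psi_n_le_1: "Psi_n f p q c n \<le> 1"
proof -
  have "card {i. i < n \<and> dist ((f ^^ i) p) ((f ^^ i) q) < c} \<le> card {..<n}" by (intro card_mono) auto
  then show ?thesis by (cases "n = 0") (auto simp: Psi_n_def xi_def)
qed

text \<open>On an even block starting at \<open>a\<close> the codes agree long beyond
  \<open>n = l * a\<close>, so \<open>agreement_close\<close> applies at all times from
  \<open>a\<close> to \<open>n\<close>. Only times below \<open>a\<close> can be far, a proportion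
  of at most 1/l.\<close>

lemma coded_points_often_close:
  assumes "c > 0" "r < 1"
  shows "\<exists>n\<ge>m. r < Psi_n skew_map (coded_point \<alpha>) (coded_point \<beta>) c n"
proof -
  obtain R where R: "(1/3) ^ R < c" using real_arch_pow_inv[of c "1/3"] \<open>c > 0\<close> by auto
  obtain k where k: "real k > 1 / (1 - r)" using reals_Archimedean2 by blast
  define l where "l = k + m + 1"
  define a :: nat where "a = fact (2 * (R + l))"
  define n where "n = l * a"
  have a: "a \<ge> 1" by (simp add: a_def)
  have "l \<ge> 1" by (simp add: l_def)
  have "n \<ge> l" using a by (simp add: n_def)
  have fact_eq: "fact (2 * (R + l) + 1) = (2 * (R + l) + 1) * a" by (simp add: a_def)
  have close: "dist ((skew_map ^^ t) (coded_point \<alpha>)) ((skew_map ^^ t) (coded_point \<beta>)) < c" if t: "a \<le> t" "t < n" for t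
  proof -
    have "R * 1 \<le> R * a" using a by (intro mult_le_mono2)
    moreover have "(2 * (R + l) + 1) * a = 2 * (R * a) + 2 * (l * a) + a" by (simp add: algebra_simps)
    ultimately have "2 * t + 2 * R \<le> fact (2 * (R + l) + 1)"
      using t(2) unfolding fact_eq n_def by linarith
    then have "\<bar>ear_orbit t (sol (block_code \<alpha>)) - ear_orbit t (sol (block_code \<beta>))\<bar> \<le> (1/3) ^ R"
      using block_code_even[of "R + l"] t(1) unfolding a_def
      by (intro agreement_close[of t "fact (2 * (R + l) + 1)"]) auto
    then have "\<bar>ear_orbit t (sol (block_code \<alpha>)) - ear_orbit t (sol (block_code \<beta>))\<bar> < c"
      using R by (rule le_less_trans)
    moreover have "d / 4 < c" if "d < c" for d using that \<open>c > 0\<close> by simp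
    ultimately show ?thesis unfolding coded_point_def dist_pt_orbits[OF sol(1) sol(1)] by blast
  qed
  have "{i. i < n \<and> c \<le> dist ((skew_map ^^ i) (coded_point \<alpha>)) ((skew_map ^^ i) (coded_point \<beta>))} \<subseteq> {..<a}"
    using close by (force simp: not_less[symmetric])
  then have "card {i. i < n \<and> c \<le> dist ((skew_map ^^ i) (coded_point \<alpha>)) ((skew_map ^^ i) (coded_point \<beta>))} \<le> a"
    using card_mono[of "{..<a}"] by fastforce
  then have "real (card {i. i < n \<and> c \<le> dist ((skew_map ^^ i) (coded_point \<alpha>)) ((skew_map ^^ i) (coded_point \<beta>))}) / real n
      \<le> real a / real n" by (intro divide_right_mono) auto
  also have "\<dots> = 1 / real l" using a by (simp add: n_def)
  also have "\<dots> < 1 - r"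
  proof -
    have "1 / (1 - r) < real l" using k by (simp add: l_def)
    then show ?thesis using \<open>r < 1\<close> \<open>l \<ge> 1\<close> by (simp add: field_simps)
  qed
  finally have "r < Psi_n skew_map (coded_point \<alpha>) (coded_point \<beta>) c n"
    using \<open>n \<ge> l\<close> \<open>l \<ge> 1\<close> by (subst Psi_n_eq) auto
  moreover have "n \<ge> m" using \<open>n \<ge> l\<close> by (simp add: l_def)
  ultimately show ?thesis by blast
qed

text \<open>At free times of an odd block with differing codes the distance is at least (1/3) / 4.
  At least half of the times below \<open>n\<close> are free and at most a quarter precede the
  block, so a quarter of all times are far.\<close>

lemma coded_points_often_far:
  assumes "\<alpha> i \<noteq> \<beta> i"
  shows "\<exists>n\<ge>m. Psi_n skew_map (coded_point \<alpha>) (coded_point \<beta>) (1/12) n \<le> 3/4"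
proof -
  \<comment> \<open>The first component selects the index where the sequences differ; the second
    makes the block late, and the added 1 ensures \<open>j \<ge> 1\<close>, hence
    \<open>4 * a \<le> n\<close>.\<close>
  define j where "j = prod_encode (i, m + 1)"
  have j_ge: "m + 1 \<le> j" unfolding j_def by (rule le_prod_encode_2)
  define a :: nat where "a = fact (2 * j + 1)"
  define n :: nat where "n = fact (2 * j + 2)"
  have n: "n = (2 * j + 2) * a" by (simp add: n_def a_def)
  have a: "a \<ge> 1" unfolding a_def by (rule fact_ge_1)
  let ?B = "{t. t < n \<and> 1/12 \<le> dist ((skew_map ^^ t) (coded_point \<alpha>)) ((skew_map ^^ t) (coded_point \<beta>))}"
  have "free_times n - {..<a} \<subseteq> ?B"
  proof
    fix t assume "t \<in> free_times n - {..<a}"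
    then have t: "t < n" "pending t = 0" "a \<le> t" by (auto simp: free_times_def)
    have "block_code \<alpha> t \<noteq> block_code \<beta> t"
      using block_code_odd[of j t] t assms unfolding a_def n_def by (simp add: j_def)
    from free_separation[of t "block_code \<alpha>" "block_code \<beta>", OF t(2) this] show "t \<in> ?B"
      using t(1) unfolding coded_point_def dist_pt_orbits[OF sol(1) sol(1)] by simp
  qed
  then have "card (free_times n - {..<a}) \<le> card ?B" by (intro card_mono) auto
  moreover have "card (free_times n) - card {..<a} \<le> card (free_times n - {..<a})"
    by (intro diff_card_le_card_Diff) simp
  moreover have "4 * a \<le> n"
  proof -
    have "4 * a \<le> (2 * j + 2) * a" using j_ge by (intro mult_le_mono1) simp
    then show ?thesis by (simp add: n)
  qed
  ultimately have "n \<le> 4 * card ?B" using card_free_times[of n] by simp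
  then have "real n \<le> real (4 * card ?B)" by (simp only: of_nat_le_iff)
  moreover have "n > 0" by (simp add: n_def)
  ultimately have "Psi_n skew_map (coded_point \<alpha>) (coded_point \<beta>) (1/12) n \<le> 3/4"
    by (subst Psi_n_eq) (auto simp: field_simps)
  moreover have "n \<ge> m"
  proof -
    have "(2 * j + 2) * 1 \<le> n" unfolding n using a by (intro mult_le_mono2)
    then have "2 * j + 2 \<le> n" by (simp only: mult_1_right)
    then show ?thesis using j_ge by linarith
  qed
  ultimately show ?thesis by blast
qed

lemma DC2_pair_coded_points:
  assumes "\<alpha> \<noteq> \<beta>" shows "DC2_pair skew_map (coded_point \<alpha>) (coded_point \<beta>)"
proof -
  let ?p = "coded_point \<alpha>" and ?q = "coded_point \<beta>"
  have upper: "Psi_upper skew_map ?p ?q c = 1" if "c > 0" for c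
  proof (rule antisym)
    show "Psi_upper skew_map ?p ?q c \<le> 1" unfolding Psi_upper_def
      by (intro Limsup_bounded always_eventually) (simp add: Psi_n_le_1)
    show "1 \<le> Psi_upper skew_map ?p ?q c"
    proof (rule ccontr)
      assume "\<not> ?thesis"
      then have "Psi_upper skew_map ?p ?q c < ereal 1" by (simp add: one_ereal_def)
      then obtain r where r: "Psi_upper skew_map ?p ?q c < ereal r" "ereal r < ereal 1"
        using ereal_dense2 by blast
      have "\<forall>\<^sub>F n in sequentially. ereal (Psi_n skew_map ?p ?q c n) < ereal r"
        using r(1) unfolding Psi_upper_def by (rule Limsup_lessD)
      then obtain m where "\<And>n. n \<ge> m \<Longrightarrow> Psi_n skew_map ?p ?q c n < r" by (auto simp: eventually_sequentially)
      then show False using coded_points_often_close[OF that, of r m \<alpha> \<beta>] r(2) by fastforce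
    qed
  qed
  obtain i where i: "\<alpha> i \<noteq> \<beta> i" using assms by blast
  have "Psi_lower skew_map ?p ?q (1/12) \<le> ereal (3/4)"
  proof (rule ccontr)
    assume "\<not> ?thesis"
    then have "\<forall>\<^sub>F n in sequentially. ereal (3/4) < ereal (Psi_n skew_map ?p ?q (1/12) n)"
      unfolding Psi_lower_def by (intro less_LiminfD) simp
    then obtain m where "\<And>n. n \<ge> m \<Longrightarrow> 3/4 < Psi_n skew_map ?p ?q (1/12) n" by (auto simp: eventually_sequentially)
    then show False using coded_points_often_far[where \<alpha> = \<alpha> and \<beta> = \<beta> and i = i and m = m, OF i] by fastforce
  qed
  also have "ereal (3/4) < 1" by (simp add: one_ereal_def)
  finally have "Psi_lower skew_map ?p ?q (1/12) < Psi_upper skew_map ?p ?q (1/12)" by (simp add: upper)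
  then show ?thesis using upper unfolding DC2_pair_def by (intro conjI exI[of _ "1/12"]) auto
qed

text \<open>Needed for the injectivity of \<open>coded_point\<close>: different sequences give
  DC2-pairs, which cannot consist of equal points.\<close>

lemma not_DC2_pair_refl: "\<not> DC2_pair f p p"
proof (rule not_DC2_pair_if_rarely_far)
  have "{i. i < n \<and> c \<le> dist ((f ^^ i) p) ((f ^^ i) p)} = {}" if "c > 0" for c :: real and n
    using that by auto
  then show "rarely_far (\<lambda>i. dist ((f ^^ i) p) ((f ^^ i) p))" unfolding rarely_far_def by simp
qed

lemma uncountable_bool_sequences: "uncountable (UNIV :: (nat \<Rightarrow> bool) set)"
proof
  assume "countable (UNIV :: (nat \<Rightarrow> bool) set)"
  then have "range (from_nat_into (UNIV :: (nat \<Rightarrow> bool) set)) = UNIV" by (intro range_from_nat_into) auto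
  then obtain n where "from_nat_into UNIV n = (\<lambda>k. \<not> from_nat_into UNIV k k)" by (metis UNIV_I imageE)
  then show False by (metis (full_types))
qed

lemma DC2_map_skew_map: "DC2_map unit_square skew_map"
  unfolding DC2_map_def
proof (intro exI conjI)
  have inj: "inj coded_point"
  proof (rule injI, rule ccontr)
    fix \<alpha> \<beta> assume "coded_point \<alpha> = coded_point \<beta>" "\<alpha> \<noteq> \<beta>"
    then show False using DC2_pair_coded_points[of \<alpha> \<beta>] not_DC2_pair_refl[of skew_map] by simp
  qed
  then show "uncountable (range coded_point)"
    using uncountable_bool_sequences countable_image_inj_on by blast
  show "DC2_scrambled unit_square skew_map (range coded_point)"
    unfolding DC2_scrambled_def
  proof (intro conjI ballI impI)
    show "range coded_point \<subseteq> unit_square" using coded_point_in_unit_square by blast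
    fix p q assume "p \<in> range coded_point" "q \<in> range coded_point" "p \<noteq> q"
    then obtain \<alpha> \<beta> where "p = coded_point \<alpha>" "q = coded_point \<beta>" "\<alpha> \<noteq> \<beta>" by blast
    then show "DC2_pair skew_map p q" using DC2_pair_coded_points[of \<alpha> \<beta>] by simp
  qed
qed

text \<open>At a free time the two symbols give \<open>\<bar>coord p\<bar> \<le> 2/3\<close> and
  \<open>\<bar>coord p\<bar> \<ge> 5/6\<close>, so each member of the cover admits only one of them.
  The absolute value removes the sign of the fibre maps.\<close>

definition ear_cover :: "(real \<times> real) set set" where
  "ear_cover = {{p \<in> unit_square. \<bar>coord p\<bar> < 5/6}, {p \<in> unit_square. \<bar>coord p\<bar> > 2/3}}"

lemma ear_cover_open: "ear_cover \<in> open_covers unit_square"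
proof -
  have "continuous_on UNIV (\<lambda>p. \<bar>coord p\<bar>)" unfolding coord_def by (intro continuous_intros)
  then have "open ((\<lambda>p. \<bar>coord p\<bar>) -` {..<5/6})" "open ((\<lambda>p. \<bar>coord p\<bar>) -` {2/3<..})"
    by (auto intro: open_vimage)
  then have "openin (top_of_set unit_square) (unit_square \<inter> (\<lambda>p. \<bar>coord p\<bar>) -` {..<5/6})"
    "openin (top_of_set unit_square) (unit_square \<inter> (\<lambda>p. \<bar>coord p\<bar>) -` {2/3<..})" by (auto intro: openin_open_Int)
  moreover have "unit_square \<inter> (\<lambda>p. \<bar>coord p\<bar>) -` {..<5/6} = {p \<in> unit_square. \<bar>coord p\<bar> < 5/6}"
    "unit_square \<inter> (\<lambda>p. \<bar>coord p\<bar>) -` {2/3<..} = {p \<in> unit_square. \<bar>coord p\<bar> > 2/3}" by auto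
  ultimately show ?thesis by (auto simp: open_covers_def ear_cover_def)
qed

lemma compact_unit_square: "compact unit_square"
  unfolding unit_square_def by (intro compact_Times compact_Icc)

text \<open>Every set of free times is realised as a code. Points with different sets are separated
  by \<open>ear_cover\<close> at some free time, so a subcover needs a separate cell for each
  set.\<close>

lemma cover_number_ge: "2 ^ card (free_times n) \<le> cover_number unit_square (iterated_join unit_square skew_map ear_cover n)"
proof -
  let ?\<V> = "iterated_join unit_square skew_map ear_cover n"
  have ne: "unit_square \<noteq> {}" using pt_in_unit_square[of 0] by auto
  have skew_map: "skew_map \<in> unit_square \<rightarrow> unit_square" using skew_map_in_unit_square by auto
  note ctx = compact_unit_square ne continuous_on_skew_map skew_map ear_cover_open
  obtain \<W> where \<W>: "\<W> \<subseteq> ?\<V>" "finite \<W>" "card \<W> = cover_number unit_square ?\<V>" "unit_square \<subseteq> \<Union>\<W>"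
    using cover_number_attained[OF ctx iterated_join_open_cover[OF ctx]] by meson
  define x where "x B = pt (sol (\<lambda>t. t \<in> B))" for B
  have x: "x B \<in> unit_square" for B unfolding x_def by (rule pt_in_unit_square[OF sol(1)])
  have "\<forall>B. \<exists>W. W \<in> \<W> \<and> x B \<in> W" using \<W>(4) x by blast
  then obtain W where W: "\<And>B. W B \<in> \<W>" "\<And>B. x B \<in> W B" by metis
  have "inj_on W (Pow (free_times n))"
  proof (rule inj_onI, rule ccontr)
    fix B B' assume BB: "B \<in> Pow (free_times n)" "B' \<in> Pow (free_times n)" "W B = W B'" "B \<noteq> B'"
    then obtain t where t: "t \<in> free_times n" "(t \<in> B) \<noteq> (t \<in> B')" by blast
    then have t': "t < n" "pending t = 0" by (auto simp: free_times_def)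
    have "W B \<in> ?\<V>" "x B \<in> W B" "x B' \<in> W B" using W \<W>(1) BB(3) by auto
    from iterated_join_same_cell[OF this t'(1)]
    obtain U where "U \<in> ear_cover" "(skew_map ^^ t) (x B) \<in> U" "(skew_map ^^ t) (x B') \<in> U" by blast
    then have "(\<bar>coord ((skew_map ^^ t) (x B))\<bar> < 5/6 \<and> \<bar>coord ((skew_map ^^ t) (x B'))\<bar> < 5/6)
        \<or> (\<bar>coord ((skew_map ^^ t) (x B))\<bar> > 2/3 \<and> \<bar>coord ((skew_map ^^ t) (x B'))\<bar> > 2/3)"
      by (auto simp: ear_cover_def)
    moreover have "\<bar>coord ((skew_map ^^ t) (x A))\<bar> = (1 + ear_orbit t (sol (\<lambda>t. t \<in> A))) / 2" for A
      unfolding x_def by (rule abs_coord_pt_orbit[OF sol(1)])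
    moreover have "ear_orbit t (sol (\<lambda>t. t \<in> A)) \<in> (if t \<in> A then {2/3..1} else {0..1/3})" for A
      using sol(2)[of t "\<lambda>t. t \<in> A"] t'(2) by (simp add: target_def)
    from this[of B] this[of B'] have "(ear_orbit t (sol (\<lambda>t. t \<in> B)) \<le> 1/3 \<and> ear_orbit t (sol (\<lambda>t. t \<in> B')) \<ge> 2/3)
        \<or> (ear_orbit t (sol (\<lambda>t. t \<in> B)) \<ge> 2/3 \<and> ear_orbit t (sol (\<lambda>t. t \<in> B')) \<le> 1/3)"
      using t(2) by (auto split: if_splits)
    ultimately show False by auto
  qed
  moreover have "W ` Pow (free_times n) \<subseteq> \<W>" using W by auto
  ultimately have "card (Pow (free_times n)) \<le> card \<W>" using \<W>(2) by (intro card_inj_on_le)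
  then show ?thesis using \<W>(3) finite_free_times by (simp add: card_Pow)
qed

lemma positive_entropy_skew_map: "topological_entropy unit_square skew_map > 0"
proof -
  have ne: "unit_square \<noteq> {}" using pt_in_unit_square[of 0] by auto
  have skew_map: "skew_map \<in> unit_square \<rightarrow> unit_square" using skew_map_in_unit_square by auto
  have "cover_entropy unit_square skew_map ear_cover \<ge> ln 2 / 2"
  proof (rule cover_entropy_ge[OF compact_unit_square ne continuous_on_skew_map skew_map ear_cover_open])
    fix n :: nat
    let ?N = "cover_number unit_square (iterated_join unit_square skew_map ear_cover n)"
    have "real n \<le> 2 * real (card (free_times n))"
      using card_free_times[of n] by (metis of_nat_le_iff of_nat_mult of_nat_numeral)
    then have "ln 2 / 2 * real n \<le> ln 2 / 2 * (2 * real (card (free_times n)))"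
      by (intro mult_left_mono) auto
    also have "\<dots> = ln (2 ^ card (free_times n))" by (simp add: ln_realpow)
    also have "\<dots> \<le> ln (real ?N)"
    proof -
      have "(2::real) ^ card (free_times n) \<le> real ?N"
        using cover_number_ge[of n] by (metis of_nat_le_iff of_nat_power of_nat_numeral)
      moreover have pos: "(0::real) < 2 ^ card (free_times n)" by simp
      ultimately have "real ?N > 0" by linarith
      from ln_le_cancel_iff[OF pos this] show ?thesis using \<open>_ \<le> real ?N\<close> by blast
    qed
    finally show "ln 2 / 2 * real n \<le> ln (real ?N)" .
  qed
  moreover have "(0::real) < ln 2 / 2" by simp
  ultimately have "0 < cover_entropy unit_square skew_map ear_cover" by linarith
  then have "0 < ereal (cover_entropy unit_square skew_map ear_cover)" by simp
  also have "\<dots> \<le> topological_entropy unit_square skew_map"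
    unfolding topological_entropy_def by (rule SUP_upper[OF ear_cover_open])
  finally show ?thesis .
qed

theorem theorem2:
  "\<exists>F. triangular_map F
     \<and> topological_entropy unit_square F > 0
     \<and> DC2_map unit_square F
     \<and> (\<forall>p\<in>unit_square. \<not> DC2_point unit_square F p)"
  by (intro exI[of _ skew_map] conjI ballI triangular_map_skew_map positive_entropy_skew_map DC2_map_skew_map no_DC2_point)

end
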